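(* Let $E$ be a pseudo-effect algebra and let $n\ge 1$ be an integer. Then $E$ is a strong $n$-perfect pseudo-effect algebra if and only if there exists a torsion-free directed po-group $G$ such that $\mathbb{Z}\overrightarrow{\times}G$ satisfies (RDP)$_1$ and $E$ is isomorphic to $\Gamma(\mathbb{Z}\overrightarrow{\times}G,(n,0))$. If this is the case, $G$ is unique (up to isomorphism) and satisfies (RDP)$_1$.
   Context: A pseudo-effect algebra (PEA) is a structure $(E;+,0,1)$ with a partial binary operation $+$ and constants $0,1$ such that for all $a,b,c\in E$: (PE1) $a+b$ and $(a+b)+c$ exist iff $b+c$ and $a+(b+c)$ exist, and then $(a+b)+c=a+(b+c)$; (PE2) there are exactly one $d\in E$ and exactly one $e\in E$ with $a+d=e+a=1$; (PE3) if $a+b$ exists, there are $d,e\in E$ with $a+b=d+a=b+e$; (PE4) if $a+1$ or $1+a$ exists, then $a=0$. Write $a^{\sim}$, $a^{-}$ for the unique elements with $a+a^{\sim}=1$, $a^{-}+a=1$, and $A^{-}=\{a^{-}\mid a\in A\}$, $A^{\sim}=\{a^{\sim}\mid a\in A\}$ for $A\subseteq E$. The order is $a\le b$ iff $a+c=b$ for some $c\in E$ (equivalently $d+a=b$ for some $d\in E$). $na$ denotes the $n$-fold sum $a+\cdots+a$ when it exists. Morphisms of PEAs are maps preserving $0$, $1$ and existing sums; an isomorphism is a bijective morphism whose inverse is a morphism. An ideal of $E$ is a nonempty subset $I$ that is downward closed and contains $i+j$ whenever $i,j\in I$ and $i+j$ exists. It is proper if $1\notin I$, and maximal if it is proper and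 not properly included in any proper ideal. An $n$-decomposition of $E$ is a tuple $(E_0,\ldots,E_n)$ of nonempty, pairwise disjoint subsets with union $E$ such that $E_i^{-}=E_i^{\sim}=E_{n-i}$ for all $i$, and such that $x\in E_i$, $y\in E_j$, $x+y$ existing imply $i+j\le n$ and $x+y\in E_{i+j}$. $E$ is $n$-perfect if (i) it has an $n$-decomposition $(E_0,\ldots,E_n)$ such that (ii) $E_i+E_j$ exists whenever $i+j<n$, i.e. $a+b$ exists for all $a\in E_i$, $b\in E_j$, and (iii) $E_0$ is the unique maximal ideal of $E$. A po-group is a (not necessarily Abelian) group $(G;+,0)$ with a partial order such that $a\le b$ implies $c+a+d\le c+b+d$; $G^+=\{g\in G\mid g\ge0\}$. It is directed if any two elements have a common upper bound, and torsion-free if $ng\ne0$ for all $g\neq0$ and nonzero integers $n$. A strong unit is $u\in G^+$ such that for every $g\in G$ there is an integer $m\ge1$ with $g\le mu$; then $(G,u)$ is called a unital po-group. For $u\in G^+$, $\Gamma(G,u)=\{x\in G\mid 0\le x\le u\}$ with $a+b$ defined iff $a\le u-b$, and then equal to the group sum; this is a PEA with constants $0,u$. $C(G)=\{c\in G\mid c+x=x+c\ \text{for all }x\in G\}$. $\mathbb{Z}\overrightarrow{\times}G$ is the group $\mathbb{Z}\times G$ with componentwise addition and the lexicographic order: $(i,g)\le(j,h)$ iff $i<j$, or $i=j$ and $g\le h$. A PEA satisfies (RDP)$_1$ if whenever $a_1+a_2=b_1+b_2$ there are $c_{11},c_{12},c_{21},c_{22}$ with $a_1=c_{11}+c_{12}$,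 $a_2=c_{21}+c_{22}$, $b_1=c_{11}+c_{21}$, $b_2=c_{12}+c_{22}$, and for all $x\le c_{12}$, $y\le c_{21}$ both $x+y$ and $y+x$ exist and are equal. A directed po-group $G$ satisfies (RDP)$_1$ if the same property holds for $G^+$. A PEA $E$ is strong $n$-perfect if $E$ is $n$-perfect, with $n$-decomposition $(E_0,\ldots,E_n)$, satisfies (RDP)$_1$, and (i) there is a torsion-free unital po-group $(H,u)$ with $E=\Gamma(H,u)$; (ii) there is $c\in E_1$ with $nc=u$ and $c\in C(H)$. *)

theory Defs
  imports "HOL-Algebra.Elementary_Groups"
begin

section \<open>Pseudo-effect algebras\<close>

text \<open>
  The partial sum is option-valued: \<open>psum E a b = Some c\<close> says that \<open>a + b\<close> exists and equals \<open>c\<close>.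
  Its values at arguments outside the carrier are irrelevant.
\<close>

record 'a pea = "'a partial_object" +
  psum :: "'a \<Rightarrow> 'a \<Rightarrow> 'a option"
  pzero :: 'a
  pone :: 'a

locale pea =
  fixes E :: "'a pea"
  assumes zero_closed: "pzero E \<in> carrier E"
    and one_closed: "pone E \<in> carrier E"
    and psum_closed:
      "\<lbrakk>a \<in> carrier E; b \<in> carrier E; psum E a b = Some c\<rbrakk> \<Longrightarrow> c \<in> carrier E"
    and PE1: "\<lbrakk>a \<in> carrier E; b \<in> carrier E; c \<in> carrier E\<rbrakk> \<Longrightarrow>
      (\<exists>d. psum E a b = Some d \<and> psum E d c = Some s) \<longleftrightarrow>
      (\<exists>e. psum E b c = Some e \<and> psum E a e = Some s)"
    and PE2_right: "a \<in> carrier E \<Longrightarrow> \<exists>!d. d \<in> carrier E \<and> psum E a d = Some (pone E)"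
    and PE2_left: "a \<in> carrier E \<Longrightarrow> \<exists>!e. e \<in> carrier E \<and> psum E e a = Some (pone E)"
    and PE3: "\<lbrakk>a \<in> carrier E; b \<in> carrier E; psum E a b = Some s\<rbrakk> \<Longrightarrow>
      \<exists>d\<in>carrier E. \<exists>e\<in>carrier E. psum E d a = Some s \<and> psum E b e = Some s"
    and PE4: "\<lbrakk>a \<in> carrier E; psum E a (pone E) \<noteq> None \<or> psum E (pone E) a \<noteq> None\<rbrakk> \<Longrightarrow>
      a = pzero E"

definition right_compl :: "'a pea \<Rightarrow> 'a \<Rightarrow> 'a" where
  "right_compl E a = (THE d. d \<in> carrier E \<and> psum E a d = Some (pone E))"

definition left_compl :: "'a pea \<Rightarrow> 'a \<Rightarrow> 'a" where
  "left_compl E a = (THE e. e \<in> carrier E \<and> psum E e a = Some (pone E))"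

definition pea_le :: "'a pea \<Rightarrow> 'a \<Rightarrow> 'a \<Rightarrow> bool" where
  "pea_le E a b \<longleftrightarrow> (\<exists>c\<in>carrier E. psum E a c = Some b)"

primrec pea_multiple :: "'a pea \<Rightarrow> nat \<Rightarrow> 'a \<Rightarrow> 'a option" where
  "pea_multiple E 0 a = Some (pzero E)"
| "pea_multiple E (Suc k) a = Option.bind (pea_multiple E k a) (\<lambda>s. psum E s a)"

definition pea_hom :: "'a pea \<Rightarrow> 'b pea \<Rightarrow> ('a \<Rightarrow> 'b) set" where
  "pea_hom E F = {f. f \<in> carrier E \<rightarrow> carrier F \<and> f (pzero E) = pzero F \<and> f (pone E) = pone F \<and>
     (\<forall>a\<in>carrier E. \<forall>b\<in>carrier E. \<forall>c\<in>carrier E.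
        psum E a b = Some c \<longrightarrow> psum F (f a) (f b) = Some (f c))}"

definition pea_iso :: "'a pea \<Rightarrow> 'b pea \<Rightarrow> ('a \<Rightarrow> 'b) set" where
  "pea_iso E F = {f. f \<in> pea_hom E F \<and> bij_betw f (carrier E) (carrier F) \<and>
     inv_into (carrier E) f \<in> pea_hom F E}"

definition pea_ideal :: "'a pea \<Rightarrow> 'a set \<Rightarrow> bool" where
  "pea_ideal E I \<longleftrightarrow> I \<subseteq> carrier E \<and> I \<noteq> {} \<and>
     (\<forall>x\<in>I. \<forall>y\<in>carrier E. pea_le E y x \<longrightarrow> y \<in> I) \<and>
     (\<forall>i\<in>I. \<forall>j\<in>I. \<forall>s. psum E i j = Some s \<longrightarrow> s \<in> I)"

definition proper_pea_ideal :: "'a pea \<Rightarrow> 'a set \<Rightarrow> bool" where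
  "proper_pea_ideal E I \<longleftrightarrow> pea_ideal E I \<and> pone E \<notin> I"

definition maximal_pea_ideal :: "'a pea \<Rightarrow> 'a set \<Rightarrow> bool" where
  "maximal_pea_ideal E I \<longleftrightarrow> proper_pea_ideal E I \<and> (\<forall>J. proper_pea_ideal E J \<longrightarrow> \<not> I \<subset> J)"

definition pea_RDP1 :: "'a pea \<Rightarrow> bool" where
  "pea_RDP1 E \<longleftrightarrow>
     (\<forall>a1\<in>carrier E. \<forall>a2\<in>carrier E. \<forall>b1\<in>carrier E. \<forall>b2\<in>carrier E.
       psum E a1 a2 \<noteq> None \<and> psum E a1 a2 = psum E b1 b2 \<longrightarrow>
       (\<exists>c11\<in>carrier E. \<exists>c12\<in>carrier E. \<exists>c21\<in>carrier E. \<exists>c22\<in>carrier E.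
          psum E c11 c12 = Some a1 \<and> psum E c21 c22 = Some a2 \<and>
          psum E c11 c21 = Some b1 \<and> psum E c12 c22 = Some b2 \<and>
          (\<forall>x\<in>carrier E. \<forall>y\<in>carrier E. pea_le E x c12 \<and> pea_le E y c21 \<longrightarrow>
             psum E x y \<noteq> None \<and> psum E x y = psum E y x)))"

definition n_decomposition :: "nat \<Rightarrow> 'a pea \<Rightarrow> (nat \<Rightarrow> 'a set) \<Rightarrow> bool" where
  "n_decomposition n E D \<longleftrightarrow>
     (\<forall>i\<le>n. D i \<noteq> {}) \<and>
     (\<forall>i\<le>n. \<forall>j\<le>n. i \<noteq> j \<longrightarrow> D i \<inter> D j = {}) \<and>
     (\<Union>i\<le>n. D i) = carrier E \<and>
     (\<forall>i\<le>n. left_compl E ` D i = D (n - i) \<and> right_compl E ` D i = D (n - i)) \<and>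
     (\<forall>i\<le>n. \<forall>j\<le>n. \<forall>x\<in>D i. \<forall>y\<in>D j. \<forall>s.
        psum E x y = Some s \<longrightarrow> i + j \<le> n \<and> s \<in> D (i + j))"

definition n_perfect_decomposition :: "nat \<Rightarrow> 'a pea \<Rightarrow> (nat \<Rightarrow> 'a set) \<Rightarrow> bool" where
  "n_perfect_decomposition n E D \<longleftrightarrow>
     n_decomposition n E D \<and>
     (\<forall>i j. i + j < n \<longrightarrow> (\<forall>a\<in>D i. \<forall>b\<in>D j. psum E a b \<noteq> None)) \<and>
     maximal_pea_ideal E (D 0) \<and> (\<forall>I. maximal_pea_ideal E I \<longrightarrow> I = D 0)"

definition n_perfect :: "nat \<Rightarrow> 'a pea \<Rightarrow> bool" where
  "n_perfect n E \<longleftrightarrow> (\<exists>D. n_perfect_decomposition n E D)"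


section \<open>Partially ordered groups\<close>

text \<open>
  The groups of HOL-Algebra are written multiplicatively, so the not necessarily Abelian sum
  \<open>a + b\<close>, the constant \<open>0\<close> and the multiple \<open>ng\<close> of the usual additive notation for po-groups
  are \<open>a \<otimes> b\<close>, \<open>\<one>\<close> and \<open>g [^] n\<close> here.
\<close>

record 'g po_group = "'g monoid" +
  po_le :: "'g \<Rightarrow> 'g \<Rightarrow> bool"

locale po_group = group G for G :: "'g po_group" +
  assumes po_refl: "reflp_on (carrier G) (po_le G)"
    and po_antisym: "antisymp_on (carrier G) (po_le G)"
    and po_trans: "transp_on (carrier G) (po_le G)"
    and po_translate:
      "\<lbrakk>a \<in> carrier G; b \<in> carrier G; c \<in> carrier G; d \<in> carrier G; po_le G a b\<rbrakk> \<Longrightarrow>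
       po_le G (c \<otimes>\<^bsub>G\<^esub> a \<otimes>\<^bsub>G\<^esub> d) (c \<otimes>\<^bsub>G\<^esub> b \<otimes>\<^bsub>G\<^esub> d)"

definition positive_cone :: "'g po_group \<Rightarrow> 'g set" where
  "positive_cone G = {g \<in> carrier G. po_le G \<one>\<^bsub>G\<^esub> g}"

definition po_directed :: "'g po_group \<Rightarrow> bool" where
  "po_directed G \<longleftrightarrow>
     (\<forall>a\<in>carrier G. \<forall>b\<in>carrier G. \<exists>c\<in>carrier G. po_le G a c \<and> po_le G b c)"

definition torsion_free :: "'g po_group \<Rightarrow> bool" where
  "torsion_free G \<longleftrightarrow>
     (\<forall>g\<in>carrier G. g \<noteq> \<one>\<^bsub>G\<^esub> \<longrightarrow> (\<forall>k::int. k \<noteq> 0 \<longrightarrow> g [^]\<^bsub>G\<^esub> k \<noteq> \<one>\<^bsub>G\<^esub>))"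

definition strong_unit :: "'g po_group \<Rightarrow> 'g \<Rightarrow> bool" where
  "strong_unit G u \<longleftrightarrow>
     u \<in> positive_cone G \<and> (\<forall>g\<in>carrier G. \<exists>m::nat. 1 \<le> m \<and> po_le G g (u [^]\<^bsub>G\<^esub> m))"

definition unital_po_group :: "'g po_group \<Rightarrow> 'g \<Rightarrow> bool" where
  "unital_po_group G u \<longleftrightarrow> po_group G \<and> strong_unit G u"

definition group_center :: "'g po_group \<Rightarrow> 'g set" where
  "group_center G = {c \<in> carrier G. \<forall>x\<in>carrier G. c \<otimes>\<^bsub>G\<^esub> x = x \<otimes>\<^bsub>G\<^esub> c}"

definition po_group_RDP1 :: "'g po_group \<Rightarrow> bool" where
  "po_group_RDP1 G \<longleftrightarrow>
     (\<forall>a1\<in>positive_cone G. \<forall>a2\<in>positive_cone G. \<forall>b1\<in>positive_cone G. \<forall>b2\<in>positive_cone G.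
       a1 \<otimes>\<^bsub>G\<^esub> a2 = b1 \<otimes>\<^bsub>G\<^esub> b2 \<longrightarrow>
       (\<exists>c11\<in>positive_cone G. \<exists>c12\<in>positive_cone G. \<exists>c21\<in>positive_cone G. \<exists>c22\<in>positive_cone G.
          c11 \<otimes>\<^bsub>G\<^esub> c12 = a1 \<and> c21 \<otimes>\<^bsub>G\<^esub> c22 = a2 \<and>
          c11 \<otimes>\<^bsub>G\<^esub> c21 = b1 \<and> c12 \<otimes>\<^bsub>G\<^esub> c22 = b2 \<and>
          (\<forall>x\<in>positive_cone G. \<forall>y\<in>positive_cone G. po_le G x c12 \<and> po_le G y c21 \<longrightarrow>
             x \<otimes>\<^bsub>G\<^esub> y = y \<otimes>\<^bsub>G\<^esub> x)))"

definition po_group_iso :: "'g po_group \<Rightarrow> 'h po_group \<Rightarrow> ('g \<Rightarrow> 'h) set" where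
  "po_group_iso G H = {h \<in> iso G H.
     \<forall>x\<in>carrier G. \<forall>y\<in>carrier G. po_le G x y \<longleftrightarrow> po_le H (h x) (h y)}"

definition unit_interval :: "'g po_group \<Rightarrow> 'g \<Rightarrow> 'g set" where
  "unit_interval G u = {x \<in> carrier G. po_le G \<one>\<^bsub>G\<^esub> x \<and> po_le G x u}"

definition Gamma :: "'g po_group \<Rightarrow> 'g \<Rightarrow> 'g pea" where
  "Gamma G u = \<lparr>carrier = unit_interval G u,
     psum = (\<lambda>a b. if a \<in> unit_interval G u \<and> b \<in> unit_interval G u \<and>
                      po_le G a (u \<otimes>\<^bsub>G\<^esub> inv\<^bsub>G\<^esub> b)
                   then Some (a \<otimes>\<^bsub>G\<^esub> b) else None),
     pzero = \<one>\<^bsub>G\<^esub>, pone = u\<rparr>"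

definition lex_int_prod :: "'g po_group \<Rightarrow> (int \<times> 'g) po_group" where
  "lex_int_prod G = \<lparr>carrier = carrier (integer_group \<times>\<times> G),
     monoid.mult = monoid.mult (integer_group \<times>\<times> G),
     one = \<one>\<^bsub>integer_group \<times>\<times> G\<^esub>,
     po_le = (\<lambda>(i, g) (j, h). i < j \<or> i = j \<and> po_le G g h)\<rparr>"


section \<open>Strong $n$-perfect pseudo-effect algebras\<close>

text \<open>
  The equality of \<open>E\<close> with an interval of \<open>H\<close> is a matter of identification: it is rendered by an
  isomorphism \<open>f\<close>, so that the condition that \<open>c\<close> be central in \<open>H\<close> becomes one on \<open>f c\<close>.
\<close>

definition strong_n_perfect_in :: "nat \<Rightarrow> 'a pea \<Rightarrow> 'h po_group \<Rightarrow> 'h \<Rightarrow> bool" where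
  "strong_n_perfect_in n E H u \<longleftrightarrow>
     (\<exists>D. n_perfect_decomposition n E D \<and> pea_RDP1 E \<and>
          unital_po_group H u \<and> torsion_free H \<and>
          (\<exists>f \<in> pea_iso E (Gamma H u).
             \<exists>c \<in> D 1. pea_multiple E n c = Some (pone E) \<and> f c \<in> group_center H))"

text \<open>
  HOL has no quantification over types, so the po-group \<open>H\<close> ranges over the po-groups on a fixed
  type. Words over two copies of \<open>'a\<close> suffice to represent every group generated by a copy of \<open>E\<close>;
  by the lemma \<open>strong_n_perfectI\<close> below, for \<open>n \<ge> 1\<close> po-groups \<open>H\<close> on arbitrary types give nothing more.
\<close>

type_synonym 'a group_word = "(bool \<times> 'a) list"

definition strong_n_perfect :: "nat \<Rightarrow> 'a pea \<Rightarrow> bool" where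
  "strong_n_perfect n E \<longleftrightarrow>
     (\<exists>(H :: 'a group_word po_group) u. strong_n_perfect_in n E H u)"

definition lex_representation :: "nat \<Rightarrow> 'a pea \<Rightarrow> 'g po_group \<Rightarrow> bool" where
  "lex_representation n E G \<longleftrightarrow>
     po_group G \<and> torsion_free G \<and> po_directed G \<and> po_group_RDP1 (lex_int_prod G) \<and>
     pea_iso E (Gamma (lex_int_prod G) (int n, \<one>\<^bsub>G\<^esub>)) \<noteq> {}"


subsection \<open>Independence of the type of $H$\<close>

lemma pea_iso_comp:
  assumes f: "f \<in> pea_iso E F" and g: "g \<in> pea_iso F K"
    and K01: "pzero K \<in> carrier K" "pone K \<in> carrier K"
  shows "g \<circ> f \<in> pea_iso E K"
proof -
  have bf: "bij_betw f (carrier E) (carrier F)" and bg: "bij_betw g (carrier F) (carrier K)"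
    using f g by (auto simp: pea_iso_def)
  have b: "bij_betw (g \<circ> f) (carrier E) (carrier K)"
    using bf bg by (rule bij_betw_trans)
  have h1: "g \<circ> f \<in> pea_hom E K"
    using f g unfolding pea_iso_def pea_hom_def by (auto simp: Pi_iff)
  have h2: "inv_into (carrier E) f \<circ> inv_into (carrier F) g \<in> pea_hom K E"
    using f g unfolding pea_iso_def pea_hom_def by (auto simp: Pi_iff)
  have eq: "inv_into (carrier E) (g \<circ> f) x = (inv_into (carrier E) f \<circ> inv_into (carrier F) g) x"
    if "x \<in> carrier K" for x
  proof -
    have "f ` carrier E = carrier F" using bf by (simp add: bij_betw_def)
    then show ?thesis
      using inv_into_comp[of g f "carrier E" x] b bf bg that
      by (simp add: bij_betw_def inj_on_def image_comp)
  qed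
  have "inv_into (carrier E) (g \<circ> f) \<in> pea_hom K E"
    using h2 K01 unfolding pea_hom_def by (auto simp: Pi_iff eq simp del: o_apply)
  then show ?thesis using b h1 by (simp add: pea_iso_def)
qed

lemma Gamma_iso:
  assumes H: "po_group H" and K: "po_group K"
    and h: "h \<in> po_group_iso H K" and u: "u \<in> positive_cone H"
  shows "h \<in> pea_iso (Gamma H u) (Gamma K (h u))"
proof -
  interpret H: po_group H by fact
  interpret K: po_group K by fact
  have hom: "h \<in> hom H K" and bij: "bij_betw h (carrier H) (carrier K)"
    and le: "\<And>x y. \<lbrakk>x \<in> carrier H; y \<in> carrier H\<rbrakk> \<Longrightarrow> po_le K (h x) (h y) \<longleftrightarrow> po_le H x y"
    using h by (auto simp: po_group_iso_def iso_def)
  have uH: "u \<in> carrier H" "po_le H \<one>\<^bsub>H\<^esub> u" using u by (auto simp: positive_cone_def)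
  have one: "h \<one>\<^bsub>H\<^esub> = \<one>\<^bsub>K\<^esub>"
    using hom_one[OF hom H.is_group K.is_group] .
  have hc: "h x \<in> carrier K" if "x \<in> carrier H" for x using hom that by (auto simp: hom_def)
  have mult: "h (x \<otimes>\<^bsub>H\<^esub> y) = h x \<otimes>\<^bsub>K\<^esub> h y" if "x \<in> carrier H" "y \<in> carrier H" for x y
    using hom that by (auto simp: hom_def)
  have invh: "h (inv\<^bsub>H\<^esub> x) = inv\<^bsub>K\<^esub> (h x)" if "x \<in> carrier H" for x
    using group_hom.hom_inv[of H K h] that hom H.is_group K.is_group
    by (simp add: group_hom_def group_hom_axioms_def)
  have ui: "h x \<in> unit_interval K (h u) \<longleftrightarrow> x \<in> unit_interval H u" if "x \<in> carrier H" for x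
    using that uH le[of x u] le[of "\<one>\<^bsub>H\<^esub>" x] one hc by (simp add: unit_interval_def)
  have sub: "unit_interval H u \<subseteq> carrier H" by (auto simp: unit_interval_def)
  have im: "h ` unit_interval H u = unit_interval K (h u)"
  proof (intro equalityI subsetI)
    fix y assume "y \<in> unit_interval K (h u)"
    moreover then obtain x where "x \<in> carrier H" "y = h x"
      using bij by (auto simp: unit_interval_def bij_betw_def)
    ultimately show "y \<in> h ` unit_interval H u" using ui by auto
  qed (use ui sub in auto)
  have bij': "bij_betw h (unit_interval H u) (unit_interval K (h u))"
    using bij sub im inj_on_subset[of h "carrier H"] by (simp add: bij_betw_def)
  have sum: "psum (Gamma K (h u)) (h a) (h b) = map_option h (psum (Gamma H u) a b)"
    if "a \<in> unit_interval H u" "b \<in> unit_interval H u" for a b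
  proof -
    have ab: "a \<in> carrier H" "b \<in> carrier H" using that sub by auto
    have "po_le K (h a) (h u \<otimes>\<^bsub>K\<^esub> inv\<^bsub>K\<^esub> (h b)) \<longleftrightarrow> po_le H a (u \<otimes>\<^bsub>H\<^esub> inv\<^bsub>H\<^esub> b)"
      using le[of a "u \<otimes>\<^bsub>H\<^esub> inv\<^bsub>H\<^esub> b"] ab uH mult[of u "inv\<^bsub>H\<^esub> b"] invh[of b] by simp
    then show ?thesis using that ab ui mult by (simp add: Gamma_def)
  qed
  have one_in: "\<one>\<^bsub>H\<^esub> \<in> unit_interval H u" and u_in: "u \<in> unit_interval H u"
    using uH H.po_refl by (auto simp: unit_interval_def reflp_on_def)
  let ?g = "inv_into (unit_interval H u) h"
  have inj: "inj_on h (unit_interval H u)" using bij' by (simp add: bij_betw_def)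
  have homh: "h \<in> pea_hom (Gamma H u) (Gamma K (h u))"
    using sum one im unfolding pea_hom_def by (auto simp: Gamma_def)
  have "?g \<in> pea_hom (Gamma K (h u)) (Gamma H u)"
    unfolding pea_hom_def
  proof (intro CollectI conjI ballI impI)
    show "?g \<in> carrier (Gamma K (h u)) \<rightarrow> carrier (Gamma H u)"
      using im by (auto simp: Gamma_def inv_into_into)
    show "?g (pzero (Gamma K (h u))) = pzero (Gamma H u)"
      using inv_into_f_f[OF inj one_in] one by (simp add: Gamma_def)
    show "?g (pone (Gamma K (h u))) = pone (Gamma H u)"
      using inv_into_f_f[OF inj u_in] by (simp add: Gamma_def)
    fix x y z
    assume "x \<in> carrier (Gamma K (h u))" "y \<in> carrier (Gamma K (h u))"
      "z \<in> carrier (Gamma K (h u))" and s: "psum (Gamma K (h u)) x y = Some z"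
    then have "x \<in> h ` unit_interval H u" "y \<in> h ` unit_interval H u"
      "z \<in> h ` unit_interval H u"
      by (simp_all add: Gamma_def im)
    then obtain a b c where abc: "a \<in> unit_interval H u" "b \<in> unit_interval H u"
      "c \<in> unit_interval H u" "x = h a" "y = h b" "z = h c"
      by blast
    obtain d where d: "psum (Gamma H u) a b = Some d" "h d = h c"
      using sum[of a b] s abc by auto
    have "d \<in> carrier H" "c \<in> carrier H"
      using d(1) sub abc by (auto simp: Gamma_def split: if_splits)
    then have "d = c" using d(2) bij by (auto simp: bij_betw_def inj_on_def)
    then show "psum (Gamma H u) (?g x) (?g y) = Some (?g z)"
      using d abc inj by simp
  qed
  then show ?thesis using homh bij' by (simp add: pea_iso_def) (simp add: Gamma_def)
qed

lemma strong_n_perfect_in_iso: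
  assumes S: "strong_n_perfect_in n E H u" and K: "po_group K" and h: "h \<in> po_group_iso H K"
  shows "strong_n_perfect_in n E K (h u)"
proof -
  obtain D f c where D: "n_perfect_decomposition n E D" "pea_RDP1 E"
    and U: "unital_po_group H u" "torsion_free H"
    and f: "f \<in> pea_iso E (Gamma H u)"
    and c: "c \<in> D 1" "pea_multiple E n c = Some (pone E)" "f c \<in> group_center H"
    using S by (auto simp: strong_n_perfect_in_def)
  have H: "po_group H" and su: "strong_unit H u" using U by (auto simp: unital_po_group_def)
  interpret H: po_group H by fact
  interpret K: po_group K by fact
  have hom: "h \<in> hom H K" and bij: "bij_betw h (carrier H) (carrier K)"
    and le: "\<And>x y. \<lbrakk>x \<in> carrier H; y \<in> carrier H\<rbrakk> \<Longrightarrow> po_le K (h x) (h y) \<longleftrightarrow> po_le H x y"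
    using h by (auto simp: po_group_iso_def iso_def)
  interpret h: group_hom H K h
    using hom H.is_group K.is_group by (simp add: group_hom_def group_hom_axioms_def)
  have u: "u \<in> positive_cone H" using su by (simp add: strong_unit_def)
  have uH: "u \<in> carrier H" "po_le H \<one>\<^bsub>H\<^esub> u" using u by (auto simp: positive_cone_def)
  have ex: "\<exists>x\<in>carrier H. y = h x" if "y \<in> carrier K" for y
    using bij that by (auto simp: bij_betw_def)
  have u': "h u \<in> positive_cone K"
    using uH le[of "\<one>\<^bsub>H\<^esub>" u] by (simp add: positive_cone_def)
  have "strong_unit K (h u)"
    unfolding strong_unit_def
  proof (intro conjI ballI u')
    fix y assume "y \<in> carrier K"
    then obtain x where x: "x \<in> carrier H" "y = h x" using ex by blast
    then obtain m :: nat where m: "1 \<le> m" "po_le H x (u [^]\<^bsub>H\<^esub> m)"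
      using su by (auto simp: strong_unit_def)
    then show "\<exists>m::nat. 1 \<le> m \<and> po_le K y (h u [^]\<^bsub>K\<^esub> m)"
      using x uH le[of x "u [^]\<^bsub>H\<^esub> m"] h.hom_nat_pow[of u m] by auto
  qed
  then have uK: "unital_po_group K (h u)" using K by (simp add: unital_po_group_def)
  have tf: "torsion_free K"
    unfolding torsion_free_def
  proof (intro ballI allI impI)
    fix y and k :: int assume "y \<in> carrier K" and y: "y \<noteq> \<one>\<^bsub>K\<^esub>" and k: "k \<noteq> 0"
    then obtain x where x: "x \<in> carrier H" "y = h x" using ex by blast
    have "x \<noteq> \<one>\<^bsub>H\<^esub>" using x y by auto
    then have "x [^]\<^bsub>H\<^esub> k \<noteq> \<one>\<^bsub>H\<^esub>" using U(2) x k by (auto simp: torsion_free_def)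
    moreover have "x [^]\<^bsub>H\<^esub> k \<in> carrier H" using x by simp
    ultimately have "h (x [^]\<^bsub>H\<^esub> k) \<noteq> \<one>\<^bsub>K\<^esub>"
      using bij inj_onD[of h "carrier H" "x [^]\<^bsub>H\<^esub> k" "\<one>\<^bsub>H\<^esub>"]
      by (auto simp: bij_betw_def)
    then show "y [^]\<^bsub>K\<^esub> k \<noteq> \<one>\<^bsub>K\<^esub>" using x h.hom_int_pow[of x k] by simp
  qed
  have "h \<circ> f \<in> pea_iso E (Gamma K (h u))"
  proof (rule pea_iso_comp[OF f Gamma_iso[OF H K h u]])
    show "pzero (Gamma K (h u)) \<in> carrier (Gamma K (h u))"
      "pone (Gamma K (h u)) \<in> carrier (Gamma K (h u))"
      using u' K.po_refl by (auto simp: Gamma_def unit_interval_def positive_cone_def reflp_on_def)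
  qed
  moreover have "h (f c) \<in> group_center K"
    unfolding group_center_def
  proof (intro CollectI conjI ballI)
    show "h (f c) \<in> carrier K" using c(3) by (auto simp: group_center_def)
    fix y assume "y \<in> carrier K"
    then obtain x where x: "x \<in> carrier H" "y = h x" using ex by blast
    have fc: "f c \<in> carrier H" "f c \<otimes>\<^bsub>H\<^esub> x = x \<otimes>\<^bsub>H\<^esub> f c"
      using c(3) x by (auto simp: group_center_def)
    show "h (f c) \<otimes>\<^bsub>K\<^esub> y = y \<otimes>\<^bsub>K\<^esub> h (f c)"
      using h.hom_mult[OF fc(1) x(1)] h.hom_mult[OF x(1) fc(1)] fc(2) x(2) by simp
  qed
  ultimately show ?thesis
    unfolding strong_n_perfect_in_def using D uK tf c by (metis comp_apply)
qed

lemma po_group_subgroup_generated: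
  assumes "po_group H"
  shows "po_group (subgroup_generated H S)"
proof -
  interpret H: po_group H by fact
  have sub: "carrier (subgroup_generated H S) \<subseteq> carrier H"
    by (rule H.carrier_subgroup_generated_subset)
  have le: "po_le (subgroup_generated H S) = po_le H" by (simp add: subgroup_generated_def)
  interpret S: group "subgroup_generated H S" by simp
  show ?thesis
  proof
    show "reflp_on (carrier (subgroup_generated H S)) (po_le (subgroup_generated H S))"
      using H.po_refl sub by (auto simp: le reflp_on_def)
    show "antisymp_on (carrier (subgroup_generated H S)) (po_le (subgroup_generated H S))"
      using H.po_antisym sub by (auto simp: le intro: antisymp_on_subset)
    show "transp_on (carrier (subgroup_generated H S)) (po_le (subgroup_generated H S))"
      using H.po_trans sub by (auto simp: le intro: transp_on_subset)
  qed (use sub H.po_translate in \<open>auto simp: le subset_iff\<close>)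
qed

lemma strong_n_perfect_in_subgroup_generated:
  assumes S: "strong_n_perfect_in n E H u" and n: "1 \<le> n"
  defines "K \<equiv> subgroup_generated H (unit_interval H u)"
  shows "strong_n_perfect_in n E K u"
proof -
  obtain D f c where D: "n_perfect_decomposition n E D" "pea_RDP1 E"
    and U: "unital_po_group H u" "torsion_free H"
    and f: "f \<in> pea_iso E (Gamma H u)"
    and c: "c \<in> D 1" "pea_multiple E n c = Some (pone E)" "f c \<in> group_center H"
    using S by (auto simp: strong_n_perfect_in_def)
  have H: "po_group H" and su: "strong_unit H u" using U by (auto simp: unital_po_group_def)
  interpret H: po_group H by fact
  have K: "po_group K" unfolding K_def by (rule po_group_subgroup_generated[OF H])
  have uH: "u \<in> carrier H" "po_le H \<one>\<^bsub>H\<^esub> u"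
    using su by (auto simp: strong_unit_def positive_cone_def)
  have sub: "carrier K \<subseteq> carrier H"
    unfolding K_def by (rule H.carrier_subgroup_generated_subset)
  have le: "po_le K = po_le H" by (simp add: K_def subgroup_generated_def)
  have mult: "monoid.mult K = monoid.mult H" and one: "\<one>\<^bsub>K\<^esub> = \<one>\<^bsub>H\<^esub>"
    by (simp_all add: K_def)
  have ui_sub: "unit_interval H u \<subseteq> carrier K"
    unfolding K_def
    by (rule H.subgroup_generated_subset_carrier_subset) (auto simp: unit_interval_def)
  have ui: "unit_interval K u = unit_interval H u"
    using ui_sub sub by (auto simp: unit_interval_def le one)
  have uK: "u \<in> carrier K"
    using ui_sub uH H.po_refl by (auto simp: unit_interval_def reflp_on_def)
  have inv: "inv\<^bsub>K\<^esub> x = inv\<^bsub>H\<^esub> x" if "x \<in> carrier K" for x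
    using that unfolding K_def by (rule H.inv_subgroup_generated)
  have Gam: "Gamma K u = Gamma H u"
    using inv ui_sub by (auto simp: Gamma_def ui le mult one fun_eq_iff)
  have npow: "x [^]\<^bsub>K\<^esub> (m::nat) = x [^]\<^bsub>H\<^esub> m" for x m
    by (simp add: nat_pow_def mult one)
  have ipow: "x [^]\<^bsub>K\<^esub> (k::int) = x [^]\<^bsub>H\<^esub> k" if "x \<in> carrier K" for x k
    using that unfolding K_def by (simp add: H.int_pow_subgroup_generated)
  have "unital_po_group K u"
    using K su sub uK
    by (auto simp: unital_po_group_def strong_unit_def positive_cone_def le one npow)
  moreover have "torsion_free K"
    using U(2) sub by (auto simp: torsion_free_def ipow one)
  moreover have "f c \<in> group_center K"
  proof -
    have "(\<Union>i\<le>n. D i) = carrier E"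
      using D(1) by (simp add: n_perfect_decomposition_def n_decomposition_def)
    then have "c \<in> carrier E"
      using c(1) n by blast
    then have "f c \<in> unit_interval H u"
      using f by (auto simp: pea_iso_def pea_hom_def Gamma_def)
    then show ?thesis using ui_sub c(3) sub by (auto simp: group_center_def mult)
  qed
  ultimately show ?thesis
    unfolding strong_n_perfect_in_def using D f c Gam by metis
qed

lemma generate_image_words:
  assumes H: "group H" and fX: "f ` X \<subseteq> carrier H" and x: "x \<in> generate H (f ` X)"
  shows "\<exists>w :: 'a group_word. x =
    foldr (\<lambda>(b, a) y. (if b then f a else inv\<^bsub>H\<^esub> (f a)) \<otimes>\<^bsub>H\<^esub> y) w \<one>\<^bsub>H\<^esub>"
proof -
  interpret H: group H by fact
  define ev where "ev w = foldr (\<lambda>(b, a) y. (if b then f a else inv\<^bsub>H\<^esub> (f a)) \<otimes>\<^bsub>H\<^esub> y) w \<one>\<^bsub>H\<^esub>"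
    for w :: "'a group_word"
  have ev_simps [simp]: "ev [] = \<one>\<^bsub>H\<^esub>"
    "ev ((b, a) # w) = (if b then f a else inv\<^bsub>H\<^esub> (f a)) \<otimes>\<^bsub>H\<^esub> ev w" for b a w
    by (simp_all add: ev_def)
  have fc: "f a \<in> carrier H" if "a \<in> X" for a using fX that by auto
  have closed: "ev w \<in> carrier H" if "snd ` set w \<subseteq> X" for w
    using that by (induction w) (auto simp: fc)
  have append: "ev (v @ w) = ev v \<otimes>\<^bsub>H\<^esub> ev w"
    if "snd ` set v \<subseteq> X" "snd ` set w \<subseteq> X" for v w
    using that by (induction v) (auto simp: fc closed H.m_assoc)
  have "\<exists>w. snd ` set w \<subseteq> X \<and> x = ev w"
    using x
  proof induction
    case one
    show ?case by (rule exI[of _ "[]"]) simp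
  next
    case (incl h)
    then obtain a where a: "a \<in> X" "h = f a" by blast
    then show ?case by (intro exI[of _ "[(True, a)]"]) (simp add: fc)
  next
    case (inv h)
    then obtain a where a: "a \<in> X" "h = f a" by blast
    then show ?case by (intro exI[of _ "[(False, a)]"]) (simp add: fc)
  next
    case (eng h1 h2)
    then obtain v w where "snd ` set v \<subseteq> X" "h1 = ev v" "snd ` set w \<subseteq> X" "h2 = ev w"
      by blast
    then show ?case by (intro exI[of _ "v @ w"]) (simp add: append image_Un)
  qed
  then show ?thesis by (auto simp: ev_def)
qed

lemma po_group_transport:
  fixes \<phi> :: "'h \<Rightarrow> 'k"
  assumes H: "po_group H" and inj: "inj_on \<phi> (carrier H)"
  shows "\<exists>K. po_group K \<and> \<phi> \<in> po_group_iso H K"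
proof -
  interpret H: po_group H by fact
  define \<psi> where "\<psi> = inv_into (carrier H) \<phi>"
  have \<psi> [simp]: "\<psi> (\<phi> x) = x" if "x \<in> carrier H" for x
    using inj that by (simp add: \<psi>_def)
  define K where "K = \<lparr>carrier = \<phi> ` carrier H,
    monoid.mult = (\<lambda>x y. \<phi> (\<psi> x \<otimes>\<^bsub>H\<^esub> \<psi> y)), one = \<phi> \<one>\<^bsub>H\<^esub>,
    po_le = (\<lambda>x y. po_le H (\<psi> x) (\<psi> y))\<rparr>"
  have K_simps [simp]: "carrier K = \<phi> ` carrier H" "x \<otimes>\<^bsub>K\<^esub> y = \<phi> (\<psi> x \<otimes>\<^bsub>H\<^esub> \<psi> y)"
    "\<one>\<^bsub>K\<^esub> = \<phi> \<one>\<^bsub>H\<^esub>" "po_le K x y = po_le H (\<psi> x) (\<psi> y)" for x y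
    by (simp_all add: K_def)
  interpret K: group K
  proof (rule groupI)
    fix x assume "x \<in> carrier K"
    then obtain a where "a \<in> carrier H" "x = \<phi> a" by auto
    then show "\<exists>y\<in>carrier K. y \<otimes>\<^bsub>K\<^esub> x = \<one>\<^bsub>K\<^esub>"
      by (intro bexI[of _ "\<phi> (inv\<^bsub>H\<^esub> a)"]) auto
  qed (auto simp: H.m_assoc)
  have "po_group K"
  proof
    show "reflp_on (carrier K) (po_le K)"
      using H.po_refl by (auto simp: reflp_on_def)
    show "antisymp_on (carrier K) (po_le K)"
      using H.po_antisym by (auto simp: antisymp_on_def)
    show "transp_on (carrier K) (po_le K)"
      using H.po_trans unfolding transp_on_def by fastforce
  qed (auto simp: H.po_translate)
  moreover have "\<phi> \<in> po_group_iso H K"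
    using inj by (auto simp: po_group_iso_def iso_def hom_def bij_betw_def)
  ultimately show ?thesis by blast
qed

lemma strong_n_perfectI:
  fixes E :: "'a pea" and H :: "'h po_group"
  assumes S: "strong_n_perfect_in n E H u" and n: "1 \<le> n"
  shows "strong_n_perfect n E"
proof -
  define K where "K = subgroup_generated H (unit_interval H u)"
  have SK: "strong_n_perfect_in n E K u"
    unfolding K_def by (rule strong_n_perfect_in_subgroup_generated[OF S n])
  obtain f where f: "f \<in> pea_iso E (Gamma H u)" and H: "po_group H"
    using S by (auto simp: strong_n_perfect_in_def unital_po_group_def)
  interpret H: po_group H by fact
  have K: "po_group K" unfolding K_def by (rule po_group_subgroup_generated[OF H])
  have im: "f ` carrier E = unit_interval H u"
    using f by (auto simp: pea_iso_def bij_betw_def Gamma_def)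
  have sub: "unit_interval H u \<subseteq> carrier H" by (auto simp: unit_interval_def)
  then have carK: "carrier K = generate H (f ` carrier E)"
    by (simp add: K_def carrier_subgroup_generated im Int_absorb1)
  define ev where "ev w = foldr (\<lambda>(b, a) y. (if b then f a else inv\<^bsub>H\<^esub> (f a)) \<otimes>\<^bsub>H\<^esub> y) w \<one>\<^bsub>H\<^esub>"
    for w :: "'a group_word"
  define \<phi> where "\<phi> x = (SOME w. x = ev w)" for x
  have "ev (\<phi> x) = x" if "x \<in> carrier K" for x
  proof -
    have "\<exists>w. x = ev w"
      unfolding ev_def
      by (rule generate_image_words[where X = "carrier E"])
        (use that carK im sub H.is_group in auto)
    then show ?thesis unfolding \<phi>_def by (metis (mono_tags, lifting) someI_ex)
  qed
  then have "inj_on \<phi> (carrier K)" by (metis inj_onI)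
  then obtain L where "po_group L" "\<phi> \<in> po_group_iso K L"
    using po_group_transport[OF K] by blast
  then show ?thesis
    using strong_n_perfect_in_iso[OF SK] by (auto simp: strong_n_perfect_def)
qed

end

theory Submission
  imports Defs
begin

text \<open>
  Suppose that \<open>E\<close> is strongly perfect, and regard it as the interval \<open>[\<one>, u]\<close> of the po-group \<open>H\<close>,
  with the central element \<open>c\<close> of degree one satisfying \<open>c [^] n = u\<close>. Let \<open>P\<close> be the set of elements of
  degree zero, the image of \<open>E\<^sub>0\<close>. It is closed under products and under conjugation by its
  own elements, so the quotients \<open>a \<otimes> inv b\<close> with \<open>a\<close>, \<open>b\<close> in \<open>P\<close> form a subgroup \<open>G\<close> of \<open>H\<close>, directed,
  torsion-free and with positive cone \<open>P\<close>; it inherits (RDP1) from the interval. The isomorphism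
  sends \<open>x\<close> of degree \<open>i\<close> to \<open>(i, inv (c [^] i) \<otimes> x)\<close>. The point is that the second component lies in \<open>G\<close>
  (\<open>offset_in_Q\<close>): as \<open>x \<le> c [^] n\<close>, the refinement property writes \<open>x\<close> as a product of elements below
  \<open>c\<close>, and each of these either has degree zero or differs from \<open>c\<close> by an element of degree zero.
  Conversely (\<open>c_pow_mult_Q\<close>), \<open>c [^] i \<otimes> g\<close> has degree \<open>i\<close> for every \<open>g\<close> in \<open>G\<close> when \<open>0 < i < n\<close>, because
  elements of degree zero lie below \<open>c [^] i\<close> and sums of total degree less than \<open>n\<close> exist.

  Property (RDP1) passes between a directed \<open>G\<close> and its lexicographic product with the integers
  (\<open>RDP1_lex_int_prod\<close>, \<open>RDP1_of_lex_int_prod\<close>), and from a po-group to its intervals.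
  For a given lexicographic representation, the parts \<open>E\<^sub>i\<close> are the levels of the integer
  component, and \<open>c\<close> is \<open>(1, \<one>)\<close>. An ideal not contained in level zero contains
  \<open>c\<close>, hence its multiples and the unit (\<open>one_in_ideal\<close>); so level zero is the unique maximal ideal.

  This last fact also gives uniqueness: level zero depends on \<open>E\<close> only, it is a copy of the
  positive cone of \<open>G\<close>, and a directed po-group is the group of quotients of its positive cone
  (\<open>po_group_iso_of_cone_iso\<close>).
\<close>


section \<open>Computing in po-groups\<close>

context po_group
begin

lemma inv_mult_cancel [simp]:
  "\<lbrakk>x \<in> carrier G; y \<in> carrier G\<rbrakk> \<Longrightarrow> inv\<^bsub>G\<^esub> x \<otimes>\<^bsub>G\<^esub> (x \<otimes>\<^bsub>G\<^esub> y) = y"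
  by (simp flip: m_assoc)

lemma mult_inv_cancel [simp]:
  "\<lbrakk>x \<in> carrier G; y \<in> carrier G\<rbrakk> \<Longrightarrow> x \<otimes>\<^bsub>G\<^esub> (inv\<^bsub>G\<^esub> x \<otimes>\<^bsub>G\<^esub> y) = y"
  by (simp flip: m_assoc)

lemma le_refl [simp]: "x \<in> carrier G \<Longrightarrow> po_le G x x"
  using po_refl by (simp add: reflp_on_def)

lemma le_antisym:
  "\<lbrakk>po_le G x y; po_le G y x; x \<in> carrier G; y \<in> carrier G\<rbrakk> \<Longrightarrow> x = y"
  using po_antisym by (auto simp: antisymp_on_def)

lemma le_trans:
  "\<lbrakk>po_le G x y; po_le G y z; x \<in> carrier G; y \<in> carrier G; z \<in> carrier G\<rbrakk> \<Longrightarrow> po_le G x z"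
  using po_trans unfolding transp_on_def by blast

lemma mult_le_mult_left:
  "\<lbrakk>po_le G a b; a \<in> carrier G; b \<in> carrier G; c \<in> carrier G\<rbrakk>
    \<Longrightarrow> po_le G (c \<otimes>\<^bsub>G\<^esub> a) (c \<otimes>\<^bsub>G\<^esub> b)"
  using po_translate[of a b c "\<one>\<^bsub>G\<^esub>"] by simp

lemma mult_le_mult_right:
  "\<lbrakk>po_le G a b; a \<in> carrier G; b \<in> carrier G; c \<in> carrier G\<rbrakk>
    \<Longrightarrow> po_le G (a \<otimes>\<^bsub>G\<^esub> c) (b \<otimes>\<^bsub>G\<^esub> c)"
  using po_translate[of a b "\<one>\<^bsub>G\<^esub>" c] by simp

lemma mult_le_mult:
  assumes "po_le G a b" "po_le G c d"
    and "a \<in> carrier G" "b \<in> carrier G" "c \<in> carrier G" "d \<in> carrier G"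
  shows "po_le G (a \<otimes>\<^bsub>G\<^esub> c) (b \<otimes>\<^bsub>G\<^esub> d)"
  by (rule le_trans[of _ "b \<otimes>\<^bsub>G\<^esub> c"])
    (use assms in \<open>auto intro: mult_le_mult_left mult_le_mult_right\<close>)

lemma le_iff_left:
  assumes "a \<in> carrier G" "b \<in> carrier G"
  shows "po_le G a b \<longleftrightarrow> po_le G \<one>\<^bsub>G\<^esub> (inv\<^bsub>G\<^esub> a \<otimes>\<^bsub>G\<^esub> b)"
  using mult_le_mult_left[of a b "inv\<^bsub>G\<^esub> a"] mult_le_mult_left[of "\<one>\<^bsub>G\<^esub>" "inv\<^bsub>G\<^esub> a \<otimes>\<^bsub>G\<^esub> b" a] assms
  by auto

lemma le_iff_right:
  assumes "a \<in> carrier G" "b \<in> carrier G"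
  shows "po_le G a b \<longleftrightarrow> po_le G \<one>\<^bsub>G\<^esub> (b \<otimes>\<^bsub>G\<^esub> inv\<^bsub>G\<^esub> a)"
  using mult_le_mult_right[of a b "inv\<^bsub>G\<^esub> a"] mult_le_mult_right[of "\<one>\<^bsub>G\<^esub>" "b \<otimes>\<^bsub>G\<^esub> inv\<^bsub>G\<^esub> a" a] assms
  by (auto simp: m_assoc)

lemma le_mult_inv_iff:
  assumes "a \<in> carrier G" "b \<in> carrier G" "c \<in> carrier G"
  shows "po_le G a (c \<otimes>\<^bsub>G\<^esub> inv\<^bsub>G\<^esub> b) \<longleftrightarrow> po_le G (a \<otimes>\<^bsub>G\<^esub> b) c"
  using assms by (simp add: le_iff_right[of a] le_iff_right[of "a \<otimes>\<^bsub>G\<^esub> b"] inv_mult_group m_assoc)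

lemma le_mult_right:
  "\<lbrakk>po_le G \<one>\<^bsub>G\<^esub> b; a \<in> carrier G; b \<in> carrier G\<rbrakk> \<Longrightarrow> po_le G a (a \<otimes>\<^bsub>G\<^esub> b)"
  using mult_le_mult_left[of "\<one>\<^bsub>G\<^esub>" b a] by simp

lemma le_mult_left:
  "\<lbrakk>po_le G \<one>\<^bsub>G\<^esub> b; a \<in> carrier G; b \<in> carrier G\<rbrakk> \<Longrightarrow> po_le G a (b \<otimes>\<^bsub>G\<^esub> a)"
  using mult_le_mult_right[of "\<one>\<^bsub>G\<^esub>" b a] by simp

lemma one_le_mult:
  "\<lbrakk>po_le G \<one>\<^bsub>G\<^esub> a; po_le G \<one>\<^bsub>G\<^esub> b; a \<in> carrier G; b \<in> carrier G\<rbrakk>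
    \<Longrightarrow> po_le G \<one>\<^bsub>G\<^esub> (a \<otimes>\<^bsub>G\<^esub> b)"
  using mult_le_mult[of "\<one>\<^bsub>G\<^esub>" a "\<one>\<^bsub>G\<^esub>" b] by simp

lemma one_le_conj:
  assumes "po_le G \<one>\<^bsub>G\<^esub> b" "a \<in> carrier G" "b \<in> carrier G"
  shows "po_le G \<one>\<^bsub>G\<^esub> (inv\<^bsub>G\<^esub> a \<otimes>\<^bsub>G\<^esub> b \<otimes>\<^bsub>G\<^esub> a)"
  using po_translate[of "\<one>\<^bsub>G\<^esub>" b "inv\<^bsub>G\<^esub> a" a] assms by simp

lemma one_le_pow:
  assumes "po_le G \<one>\<^bsub>G\<^esub> a" "a \<in> carrier G"
  shows "po_le G \<one>\<^bsub>G\<^esub> (a [^]\<^bsub>G\<^esub> (k::nat))"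
  using assms by (induction k) (auto intro: one_le_mult)

lemma directed_lower_bound:
  assumes d: "po_directed G" and ab: "a \<in> carrier G" "b \<in> carrier G"
  shows "\<exists>t\<in>carrier G. po_le G t a \<and> po_le G t b"
proof -
  obtain s where s: "s \<in> carrier G" "po_le G (inv\<^bsub>G\<^esub> a) s" "po_le G (inv\<^bsub>G\<^esub> b) s"
    using d ab unfolding po_directed_def by (meson inv_closed)
  have "po_le G (inv\<^bsub>G\<^esub> s) x" if "x \<in> carrier G" "po_le G (inv\<^bsub>G\<^esub> x) s" for x
    using that s by (simp add: le_iff_left[of "inv\<^bsub>G\<^esub> x"] le_iff_right[of "inv\<^bsub>G\<^esub> s"]
      le_iff_left[of "inv\<^bsub>G\<^esub> s"])
  then show ?thesis using s ab by (intro bexI[of _ "inv\<^bsub>G\<^esub> s"]) auto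
qed

lemma directed_quotient:
  assumes d: "po_directed G" and g: "g \<in> carrier G"
  shows "\<exists>a\<in>positive_cone G. \<exists>b\<in>positive_cone G. g = a \<otimes>\<^bsub>G\<^esub> inv\<^bsub>G\<^esub> b"
proof -
  obtain a where a: "a \<in> carrier G" "po_le G \<one>\<^bsub>G\<^esub> a" "po_le G g a"
    using d g unfolding po_directed_def by (meson one_closed)
  show ?thesis
    using a g le_iff_left[of g a]
    by (intro bexI[of _ a] bexI[of _ "inv\<^bsub>G\<^esub> g \<otimes>\<^bsub>G\<^esub> a"])
      (auto simp: positive_cone_def inv_mult_group)
qed

end


section \<open>The lexicographic product with the integers\<close>

lemma lex_int_prod_carrier [simp]: "carrier (lex_int_prod G) = UNIV \<times> carrier G"
  by (simp add: lex_int_prod_def)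

lemma lex_int_prod_mult [simp]:
  "(i, g) \<otimes>\<^bsub>lex_int_prod G\<^esub> (j, h) = (i + j, g \<otimes>\<^bsub>G\<^esub> h)"
  by (simp add: lex_int_prod_def)

lemma lex_int_prod_one [simp]: "\<one>\<^bsub>lex_int_prod G\<^esub> = (0, \<one>\<^bsub>G\<^esub>)"
  by (simp add: lex_int_prod_def)

lemma lex_int_prod_le [simp]:
  "po_le (lex_int_prod G) (i, g) (j, h) \<longleftrightarrow> i < j \<or> i = j \<and> po_le G g h"
  by (simp add: lex_int_prod_def)

lemma lex_int_prod_cone:
  "x \<in> positive_cone (lex_int_prod G) \<longleftrightarrow>
     snd x \<in> carrier G \<and> (0 < fst x \<or> fst x = 0 \<and> po_le G \<one>\<^bsub>G\<^esub> (snd x))"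
  by (cases x) (auto simp: positive_cone_def)

context po_group
begin

lemma lex_int_prod_po_group: "po_group (lex_int_prod G)"
proof -
  interpret L: group "lex_int_prod G"
  proof (rule groupI)
    fix x assume "x \<in> carrier (lex_int_prod G)"
    then show "\<exists>y\<in>carrier (lex_int_prod G). y \<otimes>\<^bsub>lex_int_prod G\<^esub> x = \<one>\<^bsub>lex_int_prod G\<^esub>"
      by (intro bexI[of _ "(- fst x, inv\<^bsub>G\<^esub> snd x)"]) auto
  qed (auto simp: m_assoc)
  show ?thesis
  proof
    show "reflp_on (carrier (lex_int_prod G)) (po_le (lex_int_prod G))"
      by (auto simp: reflp_on_def)
    show "antisymp_on (carrier (lex_int_prod G)) (po_le (lex_int_prod G))"
      by (auto simp: antisymp_on_def intro: le_antisym)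
    show "transp_on (carrier (lex_int_prod G)) (po_le (lex_int_prod G))"
    proof (rule transp_onI)
      fix x y z
      assume "x \<in> carrier (lex_int_prod G)" "y \<in> carrier (lex_int_prod G)" "z \<in> carrier (lex_int_prod G)"
        "po_le (lex_int_prod G) x y" "po_le (lex_int_prod G) y z"
      then show "po_le (lex_int_prod G) x z"
        using le_trans[of "snd x" "snd y" "snd z"] by (cases x; cases y; cases z) auto
    qed
  qed (auto simp: po_translate)
qed

lemma lex_int_prod_inv:
  assumes "g \<in> carrier G"
  shows "inv\<^bsub>lex_int_prod G\<^esub> (i, g) = (- i, inv\<^bsub>G\<^esub> g)"
proof -
  interpret L: po_group "lex_int_prod G" by (rule lex_int_prod_po_group)
  show ?thesis using assms by (intro L.inv_equality) auto
qed

lemma lex_int_prod_nat_pow: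
  "g \<in> carrier G \<Longrightarrow> (i, g) [^]\<^bsub>lex_int_prod G\<^esub> (k::nat) = (int k * i, g [^]\<^bsub>G\<^esub> k)"
  by (induction k) (auto simp: algebra_simps)

lemma lex_int_prod_int_pow:
  "g \<in> carrier G \<Longrightarrow> (i, g) [^]\<^bsub>lex_int_prod G\<^esub> (k::int) = (k * i, g [^]\<^bsub>G\<^esub> k)"
  by (cases k rule: int_cases2)
    (simp_all add: int_pow_int group.int_pow_neg_int[OF po_group.axioms(1)]
      lex_int_prod_po_group po_group_axioms lex_int_prod_nat_pow lex_int_prod_inv)

lemma lex_int_prod_torsion_free:
  "torsion_free G \<Longrightarrow> torsion_free (lex_int_prod G)"
  unfolding torsion_free_def by (force simp add: lex_int_prod_int_pow)

lemma lex_int_prod_strong_unit: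
  assumes "1 \<le> n"
  shows "strong_unit (lex_int_prod G) (int n, \<one>\<^bsub>G\<^esub>)"
  unfolding strong_unit_def
proof (intro conjI ballI)
  show "(int n, \<one>\<^bsub>G\<^esub>) \<in> positive_cone (lex_int_prod G)"
    using assms by (simp add: lex_int_prod_cone)
  fix x assume "x \<in> carrier (lex_int_prod G)"
  then obtain i g where x: "x = (i, g)" "g \<in> carrier G" by auto
  define m where "m = nat \<bar>i\<bar> + 1"
  have m: "1 \<le> m" "i < int m * 1" by (auto simp: m_def)
  note m(2)
  also have "int m * 1 \<le> int m * int n" using assms by (intro mult_left_mono) auto
  finally show "\<exists>m::nat. 1 \<le> m \<and> po_le (lex_int_prod G) x ((int n, \<one>\<^bsub>G\<^esub>) [^]\<^bsub>lex_int_prod G\<^esub> m)"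
    using x m by (intro exI[of _ m]) (simp add: lex_int_prod_nat_pow)
qed

end


section \<open>Refinement in a po-group and in its lexicographic product\<close>

text \<open>
  The two decompositions \<open>a1 \<otimes> a2\<close> and \<open>b1 \<otimes> b2\<close> of one positive element have a common refinement
  of the kind that (RDP1) asks for.
\<close>

definition RDP1_refinement :: "'g po_group \<Rightarrow> 'g \<Rightarrow> 'g \<Rightarrow> 'g \<Rightarrow> 'g \<Rightarrow> bool" where
  "RDP1_refinement G a1 a2 b1 b2 \<longleftrightarrow>
     (\<exists>c11\<in>positive_cone G. \<exists>c12\<in>positive_cone G. \<exists>c21\<in>positive_cone G. \<exists>c22\<in>positive_cone G.
        c11 \<otimes>\<^bsub>G\<^esub> c12 = a1 \<and> c21 \<otimes>\<^bsub>G\<^esub> c22 = a2 \<and>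
        c11 \<otimes>\<^bsub>G\<^esub> c21 = b1 \<and> c12 \<otimes>\<^bsub>G\<^esub> c22 = b2 \<and>
        (\<forall>x\<in>positive_cone G. \<forall>y\<in>positive_cone G. po_le G x c12 \<and> po_le G y c21 \<longrightarrow>
           x \<otimes>\<^bsub>G\<^esub> y = y \<otimes>\<^bsub>G\<^esub> x))"

lemma po_group_RDP1_iff:
  "po_group_RDP1 G \<longleftrightarrow>
     (\<forall>a1\<in>positive_cone G. \<forall>a2\<in>positive_cone G. \<forall>b1\<in>positive_cone G. \<forall>b2\<in>positive_cone G.
       a1 \<otimes>\<^bsub>G\<^esub> a2 = b1 \<otimes>\<^bsub>G\<^esub> b2 \<longrightarrow> RDP1_refinement G a1 a2 b1 b2)"
  by (simp add: po_group_RDP1_def RDP1_refinement_def)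

lemma RDP1_refinementI:
  assumes "c11 \<in> positive_cone G" "c12 \<in> positive_cone G"
    "c21 \<in> positive_cone G" "c22 \<in> positive_cone G"
    "c11 \<otimes>\<^bsub>G\<^esub> c12 = a1" "c21 \<otimes>\<^bsub>G\<^esub> c22 = a2" "c11 \<otimes>\<^bsub>G\<^esub> c21 = b1" "c12 \<otimes>\<^bsub>G\<^esub> c22 = b2"
    "\<And>x y. \<lbrakk>x \<in> positive_cone G; y \<in> positive_cone G; po_le G x c12; po_le G y c21\<rbrakk>
      \<Longrightarrow> x \<otimes>\<^bsub>G\<^esub> y = y \<otimes>\<^bsub>G\<^esub> x"
  shows "RDP1_refinement G a1 a2 b1 b2"
  unfolding RDP1_refinement_def using assms by blast

lemma RDP1_refinementE:
  assumes "RDP1_refinement G a1 a2 b1 b2"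
  obtains c11 c12 c21 c22 where
    "c11 \<in> positive_cone G" "c12 \<in> positive_cone G"
    "c21 \<in> positive_cone G" "c22 \<in> positive_cone G"
    "c11 \<otimes>\<^bsub>G\<^esub> c12 = a1" "c21 \<otimes>\<^bsub>G\<^esub> c22 = a2" "c11 \<otimes>\<^bsub>G\<^esub> c21 = b1" "c12 \<otimes>\<^bsub>G\<^esub> c22 = b2"
    "\<forall>x\<in>positive_cone G. \<forall>y\<in>positive_cone G. po_le G x c12 \<and> po_le G y c21 \<longrightarrow>
      x \<otimes>\<^bsub>G\<^esub> y = y \<otimes>\<^bsub>G\<^esub> x"
  using assms unfolding RDP1_refinement_def by blast

lemma RDP1_refinement_sym:
  assumes "RDP1_refinement G a1 a2 b1 b2"
  shows "RDP1_refinement G b1 b2 a1 a2"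
  using assms
proof (rule RDP1_refinementE)
  fix c11 c12 c21 c22
  assume c: "c11 \<in> positive_cone G" "c12 \<in> positive_cone G"
    "c21 \<in> positive_cone G" "c22 \<in> positive_cone G"
    "c11 \<otimes>\<^bsub>G\<^esub> c12 = a1" "c21 \<otimes>\<^bsub>G\<^esub> c22 = a2" "c11 \<otimes>\<^bsub>G\<^esub> c21 = b1" "c12 \<otimes>\<^bsub>G\<^esub> c22 = b2"
    and comm: "\<forall>x\<in>positive_cone G. \<forall>y\<in>positive_cone G. po_le G x c12 \<and> po_le G y c21 \<longrightarrow>
      x \<otimes>\<^bsub>G\<^esub> y = y \<otimes>\<^bsub>G\<^esub> x"
  show ?thesis
    by (rule RDP1_refinementI[OF c(1,3,2,4) c(7,8,5,6)]) (simp add: comm)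
qed

context po_group
begin

lemma RDP1_refinement_of_le:
  assumes a: "a1 \<in> positive_cone G" "a2 \<in> positive_cone G" "b1 \<in> positive_cone G" "b2 \<in> positive_cone G"
    and eq: "a1 \<otimes>\<^bsub>G\<^esub> a2 = b1 \<otimes>\<^bsub>G\<^esub> b2" and le: "po_le G a1 b1"
  shows "RDP1_refinement G a1 a2 b1 b2"
proof (rule RDP1_refinementI[of a1 G "\<one>\<^bsub>G\<^esub>" "inv\<^bsub>G\<^esub> a1 \<otimes>\<^bsub>G\<^esub> b1" b2])
  have car: "a1 \<in> carrier G" "a2 \<in> carrier G" "b1 \<in> carrier G" "b2 \<in> carrier G"
    using a by (auto simp: positive_cone_def)
  show "inv\<^bsub>G\<^esub> a1 \<otimes>\<^bsub>G\<^esub> b1 \<in> positive_cone G"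
    using le car by (simp add: positive_cone_def flip: le_iff_left)
  show "inv\<^bsub>G\<^esub> a1 \<otimes>\<^bsub>G\<^esub> b1 \<otimes>\<^bsub>G\<^esub> b2 = a2"
    using car by (simp add: m_assoc flip: eq)
  show "x \<otimes>\<^bsub>G\<^esub> y = y \<otimes>\<^bsub>G\<^esub> x"
    if "x \<in> positive_cone G" "y \<in> positive_cone G" "po_le G x \<one>\<^bsub>G\<^esub>" for x y
    using that le_antisym[of x "\<one>\<^bsub>G\<^esub>"] by (simp add: positive_cone_def)
qed (use a in \<open>auto simp: positive_cone_def\<close>)

lemma RDP1_of_lex_int_prod:
  assumes R: "po_group_RDP1 (lex_int_prod G)"
  shows "po_group_RDP1 G"
  unfolding po_group_RDP1_iff
proof (intro ballI impI)
  fix a1 a2 b1 b2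
  assume a: "a1 \<in> positive_cone G" "a2 \<in> positive_cone G"
    "b1 \<in> positive_cone G" "b2 \<in> positive_cone G" "a1 \<otimes>\<^bsub>G\<^esub> a2 = b1 \<otimes>\<^bsub>G\<^esub> b2"
  let ?L = "lex_int_prod G"
  have cone: "(0, g) \<in> positive_cone ?L \<longleftrightarrow> g \<in> positive_cone G" for g
    by (simp add: lex_int_prod_cone positive_cone_def)
  have "RDP1_refinement ?L (0, a1) (0, a2) (0, b1) (0, b2)"
    using R a by (simp add: po_group_RDP1_iff cone)
  then obtain c11 c12 c21 c22 where
    c: "c11 \<in> positive_cone ?L" "c12 \<in> positive_cone ?L"
      "c21 \<in> positive_cone ?L" "c22 \<in> positive_cone ?L"
    and s: "c11 \<otimes>\<^bsub>?L\<^esub> c12 = (0, a1)" "c21 \<otimes>\<^bsub>?L\<^esub> c22 = (0, a2)"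
      "c11 \<otimes>\<^bsub>?L\<^esub> c21 = (0, b1)" "c12 \<otimes>\<^bsub>?L\<^esub> c22 = (0, b2)"
    and comm: "\<forall>x\<in>positive_cone ?L. \<forall>y\<in>positive_cone ?L.
      po_le ?L x c12 \<and> po_le ?L y c21 \<longrightarrow> x \<otimes>\<^bsub>?L\<^esub> y = y \<otimes>\<^bsub>?L\<^esub> x"
    by (rule RDP1_refinementE)
  obtain i11 d11 where d11: "c11 = (i11, d11)" by (cases c11)
  obtain i12 d12 where d12: "c12 = (i12, d12)" by (cases c12)
  obtain i21 d21 where d21: "c21 = (i21, d21)" by (cases c21)
  obtain i22 d22 where d22: "c22 = (i22, d22)" by (cases c22)
  have "0 \<le> i11" "0 \<le> i12" "0 \<le> i21" "0 \<le> i22" "i11 + i12 = 0" "i21 + i22 = 0"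
    using c s by (auto simp: d11 d12 d21 d22 lex_int_prod_cone)
  then have z: "i11 = 0" "i12 = 0" "i21 = 0" "i22 = 0" by linarith+
  show "RDP1_refinement G a1 a2 b1 b2"
  proof (rule RDP1_refinementI[of d11 G d12 d21 d22])
    show "x \<otimes>\<^bsub>G\<^esub> y = y \<otimes>\<^bsub>G\<^esub> x"
      if "x \<in> positive_cone G" "y \<in> positive_cone G" "po_le G x d12" "po_le G y d21" for x y
      using comm[rule_format, of "(0, x)" "(0, y)"] that by (simp add: cone d12 d21 z)
  qed (use c s in \<open>simp_all add: d11 d12 d21 d22 z cone\<close>)
qed

text \<open>
  If the integer components of \<open>a1\<close> and \<open>b1\<close> differ, then \<open>a1\<close> and \<open>b1\<close> are comparable. If they agree,
  then in each of the two columns either both entries are positive in \<open>G\<close>, or the integer component is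
  positive; in the latter case a common lower bound, supplied by directedness, is split off.
  What remains is an equation between positive elements of \<open>G\<close>.
\<close>

lemma RDP1_lex_int_prod:
  assumes R: "po_group_RDP1 G" and d: "po_directed G"
  shows "po_group_RDP1 (lex_int_prod G)"
  unfolding po_group_RDP1_iff
proof (intro ballI impI)
  let ?L = "lex_int_prod G"
  interpret L: po_group ?L by (rule lex_int_prod_po_group)
  fix a1 a2 b1 b2
  assume a: "a1 \<in> positive_cone ?L" "a2 \<in> positive_cone ?L"
    "b1 \<in> positive_cone ?L" "b2 \<in> positive_cone ?L" and eq: "a1 \<otimes>\<^bsub>?L\<^esub> a2 = b1 \<otimes>\<^bsub>?L\<^esub> b2"
  obtain i1 g1 where a1: "a1 = (i1, g1)" by (cases a1)
  obtain i2 g2 where a2: "a2 = (i2, g2)" by (cases a2)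
  obtain j1 h1 where b1: "b1 = (j1, h1)" by (cases b1)
  obtain j2 h2 where b2: "b2 = (j2, h2)" by (cases b2)
  have car [simp]: "g1 \<in> carrier G" "g2 \<in> carrier G" "h1 \<in> carrier G" "h2 \<in> carrier G"
    using a by (auto simp: a1 a2 b1 b2 lex_int_prod_cone)
  consider "i1 < j1" | "j1 < i1" | "i1 = j1" by linarith
  then show "RDP1_refinement ?L a1 a2 b1 b2"
  proof cases
    case 1
    then show ?thesis using a eq by (intro L.RDP1_refinement_of_le) (simp_all add: a1 b1)
  next
    case 2
    then show ?thesis using a eq
      by (intro RDP1_refinement_sym[OF L.RDP1_refinement_of_le]) (simp_all add: a1 b1)
  next
    case 3
    then have i: "j1 = i1" "j2 = i2" and geq: "g1 \<otimes>\<^bsub>G\<^esub> g2 = h1 \<otimes>\<^bsub>G\<^esub> h2"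
      using eq by (simp_all add: a1 a2 b1 b2)
    have lower: "\<exists>t\<in>carrier G. po_le G t g \<and> po_le G t h \<and> (k = 0 \<longrightarrow> t = \<one>\<^bsub>G\<^esub>)"
      if "(k, g) \<in> positive_cone ?L" "(k, h) \<in> positive_cone ?L" for k g h
      using that directed_lower_bound[OF d, of g h] by (cases "k = 0") (auto simp: lex_int_prod_cone)
    obtain t where t: "t \<in> carrier G" "po_le G t g1" "po_le G t h1" "i1 = 0 \<longrightarrow> t = \<one>\<^bsub>G\<^esub>"
      using lower[of i1 g1 h1] a by (auto simp: a1 b1 i)
    obtain s where s: "s \<in> carrier G" "po_le G s g2" "po_le G s h2" "i2 = 0 \<longrightarrow> s = \<one>\<^bsub>G\<^esub>"
      using lower[of i2 g2 h2] a by (auto simp: a2 b2 i)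
    have "(inv\<^bsub>G\<^esub> t \<otimes>\<^bsub>G\<^esub> g1) \<otimes>\<^bsub>G\<^esub> (g2 \<otimes>\<^bsub>G\<^esub> inv\<^bsub>G\<^esub> s) = inv\<^bsub>G\<^esub> t \<otimes>\<^bsub>G\<^esub> (g1 \<otimes>\<^bsub>G\<^esub> g2) \<otimes>\<^bsub>G\<^esub> inv\<^bsub>G\<^esub> s"
      using t s by (simp add: m_assoc)
    also have "\<dots> = (inv\<^bsub>G\<^esub> t \<otimes>\<^bsub>G\<^esub> h1) \<otimes>\<^bsub>G\<^esub> (h2 \<otimes>\<^bsub>G\<^esub> inv\<^bsub>G\<^esub> s)"
      using t s by (simp add: geq m_assoc)
    finally have "RDP1_refinement G (inv\<^bsub>G\<^esub> t \<otimes>\<^bsub>G\<^esub> g1) (g2 \<otimes>\<^bsub>G\<^esub> inv\<^bsub>G\<^esub> s) (inv\<^bsub>G\<^esub> t \<otimes>\<^bsub>G\<^esub> h1) (h2 \<otimes>\<^bsub>G\<^esub> inv\<^bsub>G\<^esub> s)"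
      using R t s
      by (simp add: po_group_RDP1_iff positive_cone_def flip: le_iff_left le_iff_right)
    then obtain e11 e12 e21 e22 where
      e: "e11 \<in> positive_cone G" "e12 \<in> positive_cone G"
        "e21 \<in> positive_cone G" "e22 \<in> positive_cone G"
      and m: "e11 \<otimes>\<^bsub>G\<^esub> e12 = inv\<^bsub>G\<^esub> t \<otimes>\<^bsub>G\<^esub> g1" "e21 \<otimes>\<^bsub>G\<^esub> e22 = g2 \<otimes>\<^bsub>G\<^esub> inv\<^bsub>G\<^esub> s"
        "e11 \<otimes>\<^bsub>G\<^esub> e21 = inv\<^bsub>G\<^esub> t \<otimes>\<^bsub>G\<^esub> h1" "e12 \<otimes>\<^bsub>G\<^esub> e22 = h2 \<otimes>\<^bsub>G\<^esub> inv\<^bsub>G\<^esub> s"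
      and comm: "\<forall>x\<in>positive_cone G. \<forall>y\<in>positive_cone G.
        po_le G x e12 \<and> po_le G y e21 \<longrightarrow> x \<otimes>\<^bsub>G\<^esub> y = y \<otimes>\<^bsub>G\<^esub> x"
      by (rule RDP1_refinementE)
    have e' [simp]: "e11 \<in> carrier G" "e12 \<in> carrier G" "e21 \<in> carrier G" "e22 \<in> carrier G"
      using e by (auto simp: positive_cone_def)
    show ?thesis
    proof (rule RDP1_refinementI[of "(i1, t \<otimes>\<^bsub>G\<^esub> e11)" ?L "(0, e12)" "(0, e21)" "(i2, e22 \<otimes>\<^bsub>G\<^esub> s)"])
      show "(i1, t \<otimes>\<^bsub>G\<^esub> e11) \<in> positive_cone ?L" "(i2, e22 \<otimes>\<^bsub>G\<^esub> s) \<in> positive_cone ?L"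
        using e t s a by (auto simp: lex_int_prod_cone positive_cone_def a1 a2)
      show "(0, e12) \<in> positive_cone ?L" "(0, e21) \<in> positive_cone ?L"
        using e by (auto simp: lex_int_prod_cone positive_cone_def)
      show "(i1, t \<otimes>\<^bsub>G\<^esub> e11) \<otimes>\<^bsub>?L\<^esub> (0, e12) = a1" "(i1, t \<otimes>\<^bsub>G\<^esub> e11) \<otimes>\<^bsub>?L\<^esub> (0, e21) = b1"
        using t m by (simp_all add: a1 b1 i m_assoc)
      show "(0, e21) \<otimes>\<^bsub>?L\<^esub> (i2, e22 \<otimes>\<^bsub>G\<^esub> s) = a2" "(0, e12) \<otimes>\<^bsub>?L\<^esub> (i2, e22 \<otimes>\<^bsub>G\<^esub> s) = b2"
        using s m by (simp_all add: a2 b2 i flip: m_assoc) (simp_all add: m_assoc)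
      show "x \<otimes>\<^bsub>?L\<^esub> y = y \<otimes>\<^bsub>?L\<^esub> x"
        if "x \<in> positive_cone ?L" "y \<in> positive_cone ?L" "po_le ?L x (0, e12)" "po_le ?L y (0, e21)" for x y
        using that comm[rule_format, of "snd x" "snd y"]
        by (cases x; cases y) (auto simp: lex_int_prod_cone positive_cone_def)
    qed
  qed
qed

end


section \<open>Pseudo-effect algebras represented by intervals\<close>

text \<open>
  The partial algebra \<open>E\<close> is identified by \<open>f\<close> with the interval \<open>[\<one>, u]\<close> of \<open>H\<close>. Sums and order in \<open>E\<close>
  are then products and order in \<open>H\<close>; closure under sums has to be required, as morphisms
  carry no information on sums outside the carrier.
\<close>

locale interval_representation = po_group H
  for E :: "'a pea" and H :: "'h po_group" and u :: 'h and f :: "'a \<Rightarrow> 'h" +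
  assumes unit: "u \<in> positive_cone H"
    and iso: "f \<in> pea_iso E (Gamma H u)"
    and sum_closed: "\<lbrakk>a \<in> carrier E; b \<in> carrier E; psum E a b = Some s\<rbrakk> \<Longrightarrow> s \<in> carrier E"
    and consts_closed: "pzero E \<in> carrier E" "pone E \<in> carrier E"
begin

lemma unit_closed [simp]: "u \<in> carrier H"
  using unit by (simp add: positive_cone_def)

lemma bij: "bij_betw f (carrier E) (unit_interval H u)"
  using iso by (simp add: pea_iso_def Gamma_def)

lemma rep_interval: "x \<in> carrier E \<Longrightarrow> f x \<in> unit_interval H u"
  using bij bij_betwE by blast

lemma rep_closed [simp]: "x \<in> carrier E \<Longrightarrow> f x \<in> carrier H"
  using rep_interval by (auto simp: unit_interval_def)

lemma rep_ge_one [simp]: "x \<in> carrier E \<Longrightarrow> po_le H \<one>\<^bsub>H\<^esub> (f x)"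
  using rep_interval by (auto simp: unit_interval_def)

lemma rep_le_unit [simp]: "x \<in> carrier E \<Longrightarrow> po_le H (f x) u"
  using rep_interval by (auto simp: unit_interval_def)

lemma rep_eq_iff: "\<lbrakk>x \<in> carrier E; y \<in> carrier E\<rbrakk> \<Longrightarrow> f x = f y \<longleftrightarrow> x = y"
  using bij by (auto simp: bij_betw_def inj_on_def)

lemma rep_surj:
  assumes "g \<in> carrier H" "po_le H \<one>\<^bsub>H\<^esub> g" "po_le H g u"
  obtains x where "x \<in> carrier E" "f x = g"
proof -
  have "g \<in> f ` carrier E" using assms bij by (simp add: bij_betw_def unit_interval_def)
  then show thesis using that by blast
qed

lemma rep_zero: "f (pzero E) = \<one>\<^bsub>H\<^esub>" and rep_one: "f (pone E) = u"
  using iso by (simp_all add: pea_iso_def pea_hom_def Gamma_def)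

lemma Gamma_psum_iff:
  assumes "a \<in> unit_interval H u" "b \<in> unit_interval H u"
  shows "psum (Gamma H u) a b = Some s \<longleftrightarrow> a \<otimes>\<^bsub>H\<^esub> b = s \<and> po_le H s u"
  using assms by (auto simp: Gamma_def le_mult_inv_iff unit_interval_def)

lemma psum_iff:
  assumes "x \<in> carrier E" "y \<in> carrier E" "s \<in> carrier E"
  shows "psum E x y = Some s \<longleftrightarrow> f x \<otimes>\<^bsub>H\<^esub> f y = f s"
proof
  assume "psum E x y = Some s"
  then have "psum (Gamma H u) (f x) (f y) = Some (f s)"
    using iso assms by (simp add: pea_iso_def pea_hom_def)
  then show "f x \<otimes>\<^bsub>H\<^esub> f y = f s" using assms by (simp add: Gamma_psum_iff rep_interval)
next
  assume "f x \<otimes>\<^bsub>H\<^esub> f y = f s"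
  then have *: "psum (Gamma H u) (f x) (f y) = Some (f s)"
    using assms by (simp add: Gamma_psum_iff rep_interval)
  have inj: "inj_on f (carrier E)" using bij by (simp add: bij_betw_def)
  have "f x \<in> carrier (Gamma H u)" "f y \<in> carrier (Gamma H u)" "f s \<in> carrier (Gamma H u)"
    using assms by (simp_all add: Gamma_def rep_interval)
  then have "psum E (inv_into (carrier E) f (f x)) (inv_into (carrier E) f (f y)) =
      Some (inv_into (carrier E) f (f s))"
    using iso * by (simp add: pea_iso_def pea_hom_def)
  then show "psum E x y = Some s" using assms inj by simp
qed

lemma psum_exists_iff:
  assumes "x \<in> carrier E" "y \<in> carrier E"
  shows "psum E x y \<noteq> None \<longleftrightarrow> po_le H (f x \<otimes>\<^bsub>H\<^esub> f y) u"
proof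
  assume "psum E x y \<noteq> None"
  then obtain s where s: "psum E x y = Some s" by auto
  then have "s \<in> carrier E" using assms sum_closed by blast
  then show "po_le H (f x \<otimes>\<^bsub>H\<^esub> f y) u" using assms s by (simp add: psum_iff)
next
  assume "po_le H (f x \<otimes>\<^bsub>H\<^esub> f y) u"
  then obtain s where "s \<in> carrier E" "f s = f x \<otimes>\<^bsub>H\<^esub> f y"
    using assms by (auto intro: rep_surj[of "f x \<otimes>\<^bsub>H\<^esub> f y"] simp: one_le_mult)
  then show "psum E x y \<noteq> None" using psum_iff[of x y s] assms by auto
qed

lemma pea_le_iff:
  assumes "x \<in> carrier E" "y \<in> carrier E"
  shows "pea_le E x y \<longleftrightarrow> po_le H (f x) (f y)"
proof
  assume "pea_le E x y"
  then obtain z where "z \<in> carrier E" "psum E x z = Some y" by (auto simp: pea_le_def)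
  then show "po_le H (f x) (f y)" using assms le_mult_right[of "f z" "f x"] by (simp add: psum_iff)
next
  assume le: "po_le H (f x) (f y)"
  have "po_le H (inv\<^bsub>H\<^esub> f x \<otimes>\<^bsub>H\<^esub> f y) (f y)"
    using assms mult_le_mult_left[of "\<one>\<^bsub>H\<^esub>" "f x" "inv\<^bsub>H\<^esub> f x"]
      mult_le_mult_right[of "inv\<^bsub>H\<^esub> f x" "\<one>\<^bsub>H\<^esub>" "f y"] by simp
  then have "po_le H (inv\<^bsub>H\<^esub> f x \<otimes>\<^bsub>H\<^esub> f y) u"
    using assms le_trans[of _ "f y" u] by simp
  then obtain z where "z \<in> carrier E" "f z = inv\<^bsub>H\<^esub> f x \<otimes>\<^bsub>H\<^esub> f y"
    using assms le by (auto intro: rep_surj[of "inv\<^bsub>H\<^esub> f x \<otimes>\<^bsub>H\<^esub> f y"] simp flip: le_iff_left)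
  then show "pea_le E x y" unfolding pea_le_def
    using assms by (intro bexI[of _ z]) (simp_all add: psum_iff)
qed

lemma pea_RDP1_of_group:
  assumes R: "po_group_RDP1 H"
  shows "pea_RDP1 E"
  unfolding pea_RDP1_def
proof (intro ballI impI)
  fix a1 a2 b1 b2
  assume car: "a1 \<in> carrier E" "a2 \<in> carrier E" "b1 \<in> carrier E" "b2 \<in> carrier E"
    and eq: "psum E a1 a2 \<noteq> None \<and> psum E a1 a2 = psum E b1 b2"
  obtain s where s: "psum E a1 a2 = Some s" "psum E b1 b2 = Some s"
    using eq by (metis not_None_eq)
  have sE: "s \<in> carrier E" using s(1) car sum_closed by blast
  have a: "f a1 \<otimes>\<^bsub>H\<^esub> f a2 = f s" and b: "f b1 \<otimes>\<^bsub>H\<^esub> f b2 = f s"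
    using s car sE by (simp_all add: psum_iff)
  have "RDP1_refinement H (f a1) (f a2) (f b1) (f b2)"
    using R car a b by (simp add: po_group_RDP1_iff positive_cone_def)
  then obtain c11 c12 c21 c22 where
    c: "c11 \<in> positive_cone H" "c12 \<in> positive_cone H"
      "c21 \<in> positive_cone H" "c22 \<in> positive_cone H"
    and m: "c11 \<otimes>\<^bsub>H\<^esub> c12 = f a1" "c21 \<otimes>\<^bsub>H\<^esub> c22 = f a2"
      "c11 \<otimes>\<^bsub>H\<^esub> c21 = f b1" "c12 \<otimes>\<^bsub>H\<^esub> c22 = f b2"
    and comm: "\<forall>x\<in>positive_cone H. \<forall>y\<in>positive_cone H.
      po_le H x c12 \<and> po_le H y c21 \<longrightarrow> x \<otimes>\<^bsub>H\<^esub> y = y \<otimes>\<^bsub>H\<^esub> x"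
    by (rule RDP1_refinementE)
  have ch [simp]: "c11 \<in> carrier H" "c12 \<in> carrier H" "c21 \<in> carrier H" "c22 \<in> carrier H"
    and c1 [simp]: "po_le H \<one>\<^bsub>H\<^esub> c11" "po_le H \<one>\<^bsub>H\<^esub> c12" "po_le H \<one>\<^bsub>H\<^esub> c21" "po_le H \<one>\<^bsub>H\<^esub> c22"
    using c by (auto simp: positive_cone_def)
  have "po_le H c11 (f a1)" "po_le H c12 (f a1)" "po_le H c21 (f a2)" "po_le H c22 (f a2)"
    using le_mult_right[of c12 c11] le_mult_left[of c11 c12]
      le_mult_right[of c22 c21] le_mult_left[of c21 c22] by (simp_all add: m)
  then have cu: "po_le H c11 u" "po_le H c12 u" "po_le H c21 u" "po_le H c22 u"
    using le_trans[OF _ rep_le_unit] car by (meson ch rep_closed unit_closed)+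
  obtain d11 where d11: "d11 \<in> carrier E" "f d11 = c11" using rep_surj[of c11] cu by auto
  obtain d12 where d12: "d12 \<in> carrier E" "f d12 = c12" using rep_surj[of c12] cu by auto
  obtain d21 where d21: "d21 \<in> carrier E" "f d21 = c21" using rep_surj[of c21] cu by auto
  obtain d22 where d22: "d22 \<in> carrier E" "f d22 = c22" using rep_surj[of c22] cu by auto
  \<comment> \<open>The product of the two middle entries lies below the whole sum, hence below the unit.\<close>
  have "po_le H (c12 \<otimes>\<^bsub>H\<^esub> c21) (c11 \<otimes>\<^bsub>H\<^esub> (c12 \<otimes>\<^bsub>H\<^esub> c21) \<otimes>\<^bsub>H\<^esub> c22)"
    using po_translate[of "\<one>\<^bsub>H\<^esub>" c22 "c11 \<otimes>\<^bsub>H\<^esub> (c12 \<otimes>\<^bsub>H\<^esub> c21)" "\<one>\<^bsub>H\<^esub>"]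
      le_mult_left[of c11 "c12 \<otimes>\<^bsub>H\<^esub> c21"]
      le_trans[of "c12 \<otimes>\<^bsub>H\<^esub> c21" "c11 \<otimes>\<^bsub>H\<^esub> (c12 \<otimes>\<^bsub>H\<^esub> c21)"] by simp
  also have "c11 \<otimes>\<^bsub>H\<^esub> (c12 \<otimes>\<^bsub>H\<^esub> c21) \<otimes>\<^bsub>H\<^esub> c22 = (c11 \<otimes>\<^bsub>H\<^esub> c12) \<otimes>\<^bsub>H\<^esub> (c21 \<otimes>\<^bsub>H\<^esub> c22)"
    by (simp add: m_assoc)
  also have "\<dots> = f s" by (simp add: m a)
  finally have mid: "po_le H (c12 \<otimes>\<^bsub>H\<^esub> c21) u"
    using sE le_trans[of _ "f s" u] by simp
  have orth: "psum E x y \<noteq> None \<and> psum E x y = psum E y x"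
    if x: "x \<in> carrier E" "pea_le E x d12" and y: "y \<in> carrier E" "pea_le E y d21" for x y
  proof -
    have le: "po_le H (f x) c12" "po_le H (f y) c21"
      using x y d12 d21 by (simp_all add: pea_le_iff)
    have com: "f x \<otimes>\<^bsub>H\<^esub> f y = f y \<otimes>\<^bsub>H\<^esub> f x"
      using comm[rule_format, of "f x" "f y"] le x y by (simp add: positive_cone_def)
    have "po_le H (f x \<otimes>\<^bsub>H\<^esub> f y) u"
      using mult_le_mult[OF le] mid le_trans[of "f x \<otimes>\<^bsub>H\<^esub> f y" "c12 \<otimes>\<^bsub>H\<^esub> c21" u] x y by simp
    then have "psum E x y \<noteq> None" using x y psum_exists_iff[of x y] by blast
    then obtain t where t: "psum E x y = Some t" by auto
    then have tE: "t \<in> carrier E" using sum_closed x y by blast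
    have "f x \<otimes>\<^bsub>H\<^esub> f y = f t" using t tE x y by (simp add: psum_iff)
    then have "psum E y x = Some t" using com tE x y by (simp add: psum_iff)
    with t show ?thesis by simp
  qed
  have "psum E d11 d12 = Some a1" "psum E d21 d22 = Some a2"
    "psum E d11 d21 = Some b1" "psum E d12 d22 = Some b2"
    using car m d11 d12 d21 d22 by (simp_all add: psum_iff)
  then show "\<exists>c11\<in>carrier E. \<exists>c12\<in>carrier E. \<exists>c21\<in>carrier E. \<exists>c22\<in>carrier E.
      psum E c11 c12 = Some a1 \<and> psum E c21 c22 = Some a2 \<and>
      psum E c11 c21 = Some b1 \<and> psum E c12 c22 = Some b2 \<and>
      (\<forall>x\<in>carrier E. \<forall>y\<in>carrier E. pea_le E x c12 \<and> pea_le E y c21 \<longrightarrow>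
         psum E x y \<noteq> None \<and> psum E x y = psum E y x)"
    using orth d11(1) d12(1) d21(1) d22(1) by blast
qed

lemma RDP1_refinement_in_interval:
  assumes R: "pea_RDP1 E"
    and int: "a1 \<in> unit_interval H u" "a2 \<in> unit_interval H u"
      "b1 \<in> unit_interval H u" "b2 \<in> unit_interval H u"
    and eq: "a1 \<otimes>\<^bsub>H\<^esub> a2 = b1 \<otimes>\<^bsub>H\<^esub> b2" and le: "po_le H (a1 \<otimes>\<^bsub>H\<^esub> a2) u"
  shows "RDP1_refinement H a1 a2 b1 b2"
proof -
  have ex: "\<exists>x\<in>carrier E. f x = g" if "g \<in> unit_interval H u" for g
    using that rep_surj by (auto simp: unit_interval_def)
  obtain x1 where x1: "x1 \<in> carrier E" "f x1 = a1" using ex[OF int(1)] by blast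
  obtain x2 where x2: "x2 \<in> carrier E" "f x2 = a2" using ex[OF int(2)] by blast
  obtain y1 where y1: "y1 \<in> carrier E" "f y1 = b1" using ex[OF int(3)] by blast
  obtain y2 where y2: "y2 \<in> carrier E" "f y2 = b2" using ex[OF int(4)] by blast
  have "psum E x1 x2 \<noteq> None" using le x1 x2 psum_exists_iff[of x1 x2] by blast
  then obtain s where s: "psum E x1 x2 = Some s" by auto
  then have sE: "s \<in> carrier E" using sum_closed x1 x2 by blast
  have "psum E y1 y2 = Some s" using s sE eq x1 x2 y1 y2 by (simp add: psum_iff)
  with s have "psum E x1 x2 \<noteq> None \<and> psum E x1 x2 = psum E y1 y2" by simp
  then obtain c11 c12 c21 c22 where
    c [simp]: "c11 \<in> carrier E" "c12 \<in> carrier E" "c21 \<in> carrier E" "c22 \<in> carrier E"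
    and m: "psum E c11 c12 = Some x1" "psum E c21 c22 = Some x2"
      "psum E c11 c21 = Some y1" "psum E c12 c22 = Some y2"
    and orth: "\<forall>x\<in>carrier E. \<forall>y\<in>carrier E. pea_le E x c12 \<and> pea_le E y c21 \<longrightarrow>
         psum E x y \<noteq> None \<and> psum E x y = psum E y x"
    using R[unfolded pea_RDP1_def, rule_format, OF x1(1) x2(1) y1(1) y2(1)] by blast
  show ?thesis
  proof (rule RDP1_refinementI[of "f c11" H "f c12" "f c21" "f c22"])
    show "f c11 \<otimes>\<^bsub>H\<^esub> f c12 = a1" "f c21 \<otimes>\<^bsub>H\<^esub> f c22 = a2"
      "f c11 \<otimes>\<^bsub>H\<^esub> f c21 = b1" "f c12 \<otimes>\<^bsub>H\<^esub> f c22 = b2"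
      using m x1 x2 y1 y2 by (simp_all add: psum_iff)
    fix g h
    assume g: "g \<in> positive_cone H" "po_le H g (f c12)" and h: "h \<in> positive_cone H" "po_le H h (f c21)"
    have "po_le H g u" "po_le H h u"
      using g h le_trans[of g "f c12" u] le_trans[of h "f c21" u] by (simp_all add: positive_cone_def)
    then obtain x y where x: "x \<in> carrier E" "f x = g" and y: "y \<in> carrier E" "f y = h"
      using g h rep_surj by (metis (no_types, lifting) mem_Collect_eq positive_cone_def)
    have "psum E x y \<noteq> None \<and> psum E x y = psum E y x"
      using x y g h by (intro orth[rule_format]) (simp_all add: pea_le_iff)
    then obtain t where t: "psum E x y = Some t" "psum E y x = Some t"
      by (metis not_None_eq)
    then have "t \<in> carrier E" using sum_closed x y by blast
    then show "g \<otimes>\<^bsub>H\<^esub> h = h \<otimes>\<^bsub>H\<^esub> g" using t x y by (simp add: psum_iff)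
  qed (simp_all add: positive_cone_def)
qed

end


section \<open>Intervals in a lexicographic product are strongly perfect\<close>

text \<open>
  A representation of \<open>E\<close> by the interval from the neutral element to \<open>(n, \<one>)\<close>
  in the lexicographic product of the integers with a directed po-group \<open>G\<close>.
\<close>

locale lex_interval_representation =
  G: po_group G + interval_representation E "lex_int_prod G" "(int n, \<one>\<^bsub>G\<^esub>)" f + pea E
  for E :: "'a pea" and G :: "'g po_group" and n :: nat and f :: "'a \<Rightarrow> int \<times> 'g" +
  assumes directed: "po_directed G" and n_pos: "1 \<le> n"
begin

text \<open>The elements of \<open>E\<close> whose image has integer component \<open>i\<close>.\<close>

definition level :: "nat \<Rightarrow> 'a set" where
  "level i = {x \<in> carrier E. fst (f x) = int i}"

lemma snd_closed [simp]: "x \<in> carrier E \<Longrightarrow> snd (f x) \<in> carrier G"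
  using rep_closed[of x] by (auto simp: mem_Times_iff)

lemma fst_nonneg: "x \<in> carrier E \<Longrightarrow> 0 \<le> fst (f x)"
  using rep_ge_one[of x] by (cases "f x") auto

lemma fst_le: "x \<in> carrier E \<Longrightarrow> fst (f x) \<le> int n"
  using rep_le_unit[of x] by (cases "f x") auto

lemma ex_rep:
  assumes "g \<in> carrier G" "0 < i \<or> i = 0 \<and> po_le G \<one>\<^bsub>G\<^esub> g" "i < int n \<or> i = int n \<and> po_le G g \<one>\<^bsub>G\<^esub>"
  shows "\<exists>x\<in>carrier E. f x = (i, g)"
  by (rule rep_surj[of "(i, g)"]) (use assms in auto)

lemma ex_multiple: "k \<le> n \<Longrightarrow> \<exists>x\<in>carrier E. f x = (int k, \<one>\<^bsub>G\<^esub>)"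
  by (rule ex_rep) auto

lemma psum_mult:
  "\<lbrakk>x \<in> carrier E; y \<in> carrier E; psum E x y = Some s\<rbrakk> \<Longrightarrow> f x \<otimes>\<^bsub>lex_int_prod G\<^esub> f y = f s"
  using psum_iff sum_closed by blast

lemma fst_psum:
  "\<lbrakk>x \<in> carrier E; y \<in> carrier E; psum E x y = Some s\<rbrakk> \<Longrightarrow> fst (f s) = fst (f x) + fst (f y)"
  using psum_mult[of x y s] by (cases "f x"; cases "f y"; cases "f s") auto

lemma le_of_fst_less:
  assumes "x \<in> carrier E" "y \<in> carrier E" "fst (f x) < fst (f y)"
  shows "pea_le E x y"
  using assms by (cases "f x"; cases "f y") (simp add: pea_le_iff)

lemma fst_mono:
  assumes "x \<in> carrier E" "y \<in> carrier E" "pea_le E x y"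
  shows "fst (f x) \<le> fst (f y)"
  using assms by (cases "f x"; cases "f y") (auto simp: pea_le_iff)

lemma left_compl: "x \<in> carrier E \<Longrightarrow> left_compl E x \<in> carrier E \<and> psum E (left_compl E x) x = Some (pone E)"
  unfolding left_compl_def by (rule theI') (rule PE2_left)

lemma right_compl: "x \<in> carrier E \<Longrightarrow> right_compl E x \<in> carrier E \<and> psum E x (right_compl E x) = Some (pone E)"
  unfolding right_compl_def by (rule theI') (rule PE2_right)

lemma left_right_compl: "x \<in> carrier E \<Longrightarrow> left_compl E (right_compl E x) = x"
  using left_compl right_compl PE2_left by metis

lemma right_left_compl: "x \<in> carrier E \<Longrightarrow> right_compl E (left_compl E x) = x"
  using left_compl right_compl PE2_right by metis

lemma left_compl_level: "\<lbrakk>i \<le> n; x \<in> level i\<rbrakk> \<Longrightarrow> left_compl E x \<in> level (n - i)"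
  using left_compl[of x] fst_psum[of "left_compl E x" x "pone E"] by (auto simp: level_def rep_one)

lemma right_compl_level: "\<lbrakk>i \<le> n; x \<in> level i\<rbrakk> \<Longrightarrow> right_compl E x \<in> level (n - i)"
  using right_compl[of x] fst_psum[of x "right_compl E x" "pone E"] by (auto simp: level_def rep_one)

lemma level_compl_image:
  assumes "i \<le> n"
  shows "left_compl E ` level i = level (n - i)" "right_compl E ` level i = level (n - i)"
proof -
  have car: "level j \<subseteq> carrier E" for j by (auto simp: level_def)
  have n: "n - i \<le> n" "n - (n - i) = i" using assms by auto
  show "left_compl E ` level i = level (n - i)"
  proof
    show "level (n - i) \<subseteq> left_compl E ` level i"
    proof
      fix x assume x: "x \<in> level (n - i)"
      then have "right_compl E x \<in> level i" using right_compl_level[OF n(1) x] n by simp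
      moreover have "x = left_compl E (right_compl E x)"
        using left_right_compl x car by (metis subsetD)
      ultimately show "x \<in> left_compl E ` level i" by blast
    qed
  qed (use left_compl_level assms in blast)
  show "right_compl E ` level i = level (n - i)"
  proof
    show "level (n - i) \<subseteq> right_compl E ` level i"
    proof
      fix x assume x: "x \<in> level (n - i)"
      then have "left_compl E x \<in> level i" using left_compl_level[OF n(1) x] n by simp
      moreover have "x = right_compl E (left_compl E x)"
        using right_left_compl x car by (metis subsetD)
      ultimately show "x \<in> right_compl E ` level i" by blast
    qed
  qed (use right_compl_level assms in blast)
qed

lemma level_n_decomposition: "n_decomposition n E level"
  unfolding n_decomposition_def
proof (intro conjI allI impI ballI)
  fix i assume i: "i \<le> n"
  obtain x where "x \<in> carrier E" "f x = (int i, \<one>\<^bsub>G\<^esub>)"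
    using ex_multiple[OF i] by blast
  then show "level i \<noteq> {}" by (auto simp: level_def)
  show "left_compl E ` level i = level (n - i)" "right_compl E ` level i = level (n - i)"
    using level_compl_image i by auto
next
  show "(\<Union>i\<le>n. level i) = carrier E"
  proof (intro equalityI subsetI)
    fix x assume x: "x \<in> carrier E"
    then have "x \<in> level (nat (fst (f x)))" "nat (fst (f x)) \<le> n"
      using fst_nonneg[OF x] fst_le[OF x] by (auto simp: level_def)
    then show "x \<in> (\<Union>i\<le>n. level i)" by blast
  qed (auto simp: level_def)
next
  fix i j x y s assume "x \<in> level i" "y \<in> level j" and s: "psum E x y = Some s"
  then have xy: "x \<in> carrier E" "y \<in> carrier E" "fst (f x) = int i" "fst (f y) = int j"
    by (auto simp: level_def)
  have sE: "s \<in> carrier E" using sum_closed xy s by blast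
  have "fst (f s) = int (i + j)" using fst_psum[OF xy(1,2) s] xy by simp
  then show "i + j \<le> n" "s \<in> level (i + j)" using fst_le[OF sE] sE by (auto simp: level_def)
qed (auto simp: level_def)

lemma level_psum_exists:
  assumes "i + j < n" "a \<in> level i" "b \<in> level j"
  shows "psum E a b \<noteq> None"
proof -
  have "po_le (lex_int_prod G) (f a \<otimes>\<^bsub>lex_int_prod G\<^esub> f b) (int n, \<one>\<^bsub>G\<^esub>)"
    using assms by (cases "f a"; cases "f b") (auto simp: level_def)
  then show ?thesis using assms psum_exists_iff[of a b] by (auto simp: level_def)
qed

lemma level_0_proper_ideal: "proper_pea_ideal E (level 0)"
  unfolding proper_pea_ideal_def pea_ideal_def
proof (intro conjI ballI allI impI)
  show "level 0 \<noteq> {}" using level_n_decomposition by (simp add: n_decomposition_def)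
  show "pone E \<notin> level 0" using n_pos by (simp add: level_def rep_one)
  show "y \<in> level 0" if "x \<in> level 0" "y \<in> carrier E" "pea_le E y x" for x y
    using that fst_mono[of y x] fst_nonneg[of y] by (simp add: level_def)
  show "s \<in> level 0" if "x \<in> level 0" "y \<in> level 0" "psum E x y = Some s" for x y s
    using that sum_closed[of x y s] fst_psum[of x y s] by (simp add: level_def)
qed (auto simp: level_def)

text \<open>
  An ideal with an element \<open>x\<close> outside \<open>level 0\<close> contains all of \<open>level 0\<close>. It then also contains
  the element \<open>c\<close> with image \<open>(1, \<one>)\<close>: \<open>x\<close> can be enlarged within the ideal by any
  element of \<open>level 0\<close> for which the sum exists, and directedness provides one that lifts \<open>x\<close>
  above \<open>c\<close>.
\<close>

lemma one_in_ideal: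
  assumes J: "pea_ideal E J" and x: "x \<in> J" "x \<notin> level 0"
  shows "pone E \<in> J"
proof -
  have sub: "J \<subseteq> carrier E" using J by (simp add: pea_ideal_def)
  have down: "z \<in> J" if "y \<in> J" "z \<in> carrier E" "pea_le E z y" for y z
    using J that unfolding pea_ideal_def by blast
  have add: "s \<in> J" if "y \<in> J" "z \<in> J" "psum E y z = Some s" for y z s
    using J that unfolding pea_ideal_def by blast
  have xE: "x \<in> carrier E" using x sub by blast
  obtain i g where fx: "f x = (i, g)" by (cases "f x")
  have g: "g \<in> carrier G" using snd_closed[OF xE] fx by simp
  have i: "1 \<le> i" using x fst_nonneg[OF xE] xE fx by (auto simp: level_def)
  obtain c where c: "c \<in> carrier E" "f c = (1, \<one>\<^bsub>G\<^esub>)"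
    using ex_multiple[OF n_pos] by auto
  have "c \<in> J"
  proof (cases "i = 1")
    case False
    then show ?thesis using i c fx by (intro down[OF x(1) c(1)] le_of_fst_less[OF c(1) xE]) simp
  next
    case True
    obtain a where a: "a \<in> carrier G" "po_le G \<one>\<^bsub>G\<^esub> a" "po_le G \<one>\<^bsub>G\<^esub> (g \<otimes>\<^bsub>G\<^esub> a)"
      "1 < n \<or> g \<otimes>\<^bsub>G\<^esub> a = \<one>\<^bsub>G\<^esub>"
    proof (cases "n = 1")
      case True
      then have "po_le G g \<one>\<^bsub>G\<^esub>" using rep_le_unit[OF xE] fx \<open>i = 1\<close> by simp
      then show thesis using that[of "inv\<^bsub>G\<^esub> g"] g G.le_iff_left[of g "\<one>\<^bsub>G\<^esub>"] by simp
    next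
      case False
      obtain a where "a \<in> carrier G" "po_le G \<one>\<^bsub>G\<^esub> a" "po_le G (inv\<^bsub>G\<^esub> g) a"
        using directed g unfolding po_directed_def by (meson G.inv_closed G.one_closed)
      then show thesis using that[of a] g G.le_iff_left[of "inv\<^bsub>G\<^esub> g" a] n_pos False by simp
    qed
    obtain z where z: "z \<in> carrier E" "f z = (0, a)"
      using ex_rep[of a 0] a n_pos by auto
    have "z \<in> J"
      using True fx z by (intro down[OF x(1) z(1)] le_of_fst_less[OF z(1) xE]) simp
    obtain y where y: "y \<in> carrier E" "f y = (1, g \<otimes>\<^bsub>G\<^esub> a)"
      using ex_rep[of "g \<otimes>\<^bsub>G\<^esub> a" 1] a g n_pos by (cases "n = 1") auto
    have "psum E x z = Some y" using xE z y fx True by (simp add: psum_iff)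
    then have "y \<in> J" using add x(1) \<open>z \<in> J\<close> by blast
    moreover have "pea_le E c y" using c y a by (simp add: pea_le_iff)
    ultimately show ?thesis using down c(1) by blast
  qed
  have mult: "\<exists>y\<in>J. f y = (int k, \<one>\<^bsub>G\<^esub>)" if "1 \<le> k" "k \<le> n" for k
    using that
  proof (induction k rule: nat_induct_at_least)
    case base
    then show ?case using c \<open>c \<in> J\<close> by auto
  next
    case (Suc k)
    then obtain y where y: "y \<in> J" "f y = (int k, \<one>\<^bsub>G\<^esub>)" by auto
    obtain s where s: "s \<in> carrier E" "f s = (int (Suc k), \<one>\<^bsub>G\<^esub>)"
      using ex_multiple[OF Suc.prems(1)] by blast
    have "y \<in> carrier E" using y sub by blast
    then have "psum E y c = Some s" using y s c by (simp add: psum_iff)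
    then show ?case using add[OF y(1) \<open>c \<in> J\<close>] s by blast
  qed
  obtain y where "y \<in> J" "f y = f (pone E)" using mult[of n] n_pos by (auto simp: rep_one)
  then show ?thesis using rep_eq_iff[of y "pone E"] sub consts_closed by auto
qed

lemma maximal_ideal_iff: "maximal_pea_ideal E I \<longleftrightarrow> I = level 0"
  using level_0_proper_ideal one_in_ideal
  unfolding maximal_pea_ideal_def proper_pea_ideal_def by blast

lemma level_n_perfect: "n_perfect_decomposition n E level"
  unfolding n_perfect_decomposition_def
  using level_n_decomposition level_psum_exists maximal_ideal_iff by blast

lemma strongly_perfect:
  assumes R: "po_group_RDP1 (lex_int_prod G)" and tf: "torsion_free G"
  shows "strong_n_perfect_in n E (lex_int_prod G) (int n, \<one>\<^bsub>G\<^esub>)"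
proof -
  obtain c where c: "c \<in> carrier E" "f c = (1, \<one>\<^bsub>G\<^esub>)"
    using ex_multiple[OF n_pos] by auto
  have mult: "\<exists>y\<in>carrier E. pea_multiple E k c = Some y \<and> f y = (int k, \<one>\<^bsub>G\<^esub>)" if "k \<le> n" for k
    using that
  proof (induction k)
    case 0
    then show ?case using consts_closed rep_zero by auto
  next
    case (Suc k)
    then obtain y where y: "y \<in> carrier E" "pea_multiple E k c = Some y" "f y = (int k, \<one>\<^bsub>G\<^esub>)"
      by auto
    obtain s where s: "s \<in> carrier E" "f s = (int (Suc k), \<one>\<^bsub>G\<^esub>)"
      using ex_multiple[OF Suc.prems(1)] by blast
    have "psum E y c = Some s" using y s c by (simp add: psum_iff)
    then show ?case using y s by auto
  qed
  obtain y where "y \<in> carrier E" "pea_multiple E n c = Some y" "f y = f (pone E)"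
    using mult[of n] by (auto simp: rep_one)
  then have "pea_multiple E n c = Some (pone E)" using rep_eq_iff consts_closed by auto
  moreover have "c \<in> level 1" using c by (simp add: level_def)
  moreover have "f c \<in> group_center (lex_int_prod G)"
    using c by (auto simp: group_center_def)
  moreover have "unital_po_group (lex_int_prod G) (int n, \<one>\<^bsub>G\<^esub>)"
    using G.lex_int_prod_po_group G.lex_int_prod_strong_unit[OF n_pos] by (simp add: unital_po_group_def)
  ultimately show ?thesis
    unfolding strong_n_perfect_in_def
    by (intro exI[of _ level] conjI bexI[of _ f] bexI[of _ c] level_n_perfect
        pea_RDP1_of_group[OF R] G.lex_int_prod_torsion_free[OF tf] iso)
qed

end

lemma lex_interval_representationI:
  assumes E: "pea E" and n: "1 \<le> n" and G: "po_group G" "po_directed G"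
    and f: "f \<in> pea_iso E (Gamma (lex_int_prod G) (int n, \<one>\<^bsub>G\<^esub>))"
  shows "lex_interval_representation E G n f"
proof -
  interpret E: pea E by fact
  interpret G: po_group G by fact
  interpret L: po_group "lex_int_prod G" by (rule G.lex_int_prod_po_group)
  show ?thesis
  proof (unfold_locales, goal_cases)
    case 1
    show ?case using n by (simp add: lex_int_prod_cone)
  next
    case (3 a b s)
    then show ?case by (rule E.psum_closed)
  qed (fact f E.zero_closed E.one_closed G(2) n)+
qed


section \<open>From a strongly perfect interval to a lexicographic product\<close>

lemma Gamma_isoI:
  assumes H: "po_group H" and K: "po_group K"
    and u: "u \<in> positive_cone H" and v: "v \<in> positive_cone K"
    and bij: "bij_betw h (unit_interval H u) (unit_interval K v)"
    and const: "h \<one>\<^bsub>H\<^esub> = \<one>\<^bsub>K\<^esub>" "h u = v"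
    and mult: "\<And>x y s. \<lbrakk>x \<in> unit_interval H u; y \<in> unit_interval H u; s \<in> unit_interval H u\<rbrakk>
      \<Longrightarrow> x \<otimes>\<^bsub>H\<^esub> y = s \<longleftrightarrow> h x \<otimes>\<^bsub>K\<^esub> h y = h s"
  shows "h \<in> pea_iso (Gamma H u) (Gamma K v)"
proof -
  let ?I = "unit_interval H u" and ?J = "unit_interval K v"
  interpret H: po_group H by fact
  interpret K: po_group K by fact
  have psumH: "psum (Gamma H u) x y = Some s \<longleftrightarrow> x \<otimes>\<^bsub>H\<^esub> y = s" if "x \<in> ?I" "y \<in> ?I" "s \<in> ?I" for x y s
    using that u by (auto simp: Gamma_def H.le_mult_inv_iff unit_interval_def positive_cone_def)
  have psumK: "psum (Gamma K v) x y = Some s \<longleftrightarrow> x \<otimes>\<^bsub>K\<^esub> y = s" if "x \<in> ?J" "y \<in> ?J" "s \<in> ?J" for x y s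
    using that v by (auto simp: Gamma_def K.le_mult_inv_iff unit_interval_def positive_cone_def)
  let ?h' = "inv_into ?I h"
  have h: "h x \<in> ?J" if "x \<in> ?I" for x using bij that by (auto simp: bij_betw_def)
  have h': "?h' y \<in> ?I" "h (?h' y) = y" if "y \<in> ?J" for y
    using bij that by (auto simp: bij_betw_def inv_into_into f_inv_into_f)
  have one: "\<one>\<^bsub>H\<^esub> \<in> ?I" "u \<in> ?I" using u by (auto simp: unit_interval_def positive_cone_def)
  have inj: "inj_on h ?I" using bij by (simp add: bij_betw_def)
  have h'c: "?h' \<one>\<^bsub>K\<^esub> = \<one>\<^bsub>H\<^esub>" "?h' v = u"
    using inv_into_f_f[OF inj one(1)] inv_into_f_f[OF inj one(2)] const by simp_all
  have "h \<in> pea_hom (Gamma H u) (Gamma K v)"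
    unfolding pea_hom_def
  proof (intro CollectI conjI ballI impI)
    fix a b s assume "a \<in> carrier (Gamma H u)" "b \<in> carrier (Gamma H u)" "s \<in> carrier (Gamma H u)"
      and s: "psum (Gamma H u) a b = Some s"
    then have i: "a \<in> ?I" "b \<in> ?I" "s \<in> ?I" by (simp_all add: Gamma_def)
    then show "psum (Gamma K v) (h a) (h b) = Some (h s)"
      using s psumH[OF i] psumK[of "h a" "h b" "h s"] mult[OF i] h by simp
  qed (use const h in \<open>simp_all add: Gamma_def\<close>)
  moreover have "?h' \<in> pea_hom (Gamma K v) (Gamma H u)"
    unfolding pea_hom_def
  proof (intro CollectI conjI ballI impI)
    fix a b s assume "a \<in> carrier (Gamma K v)" "b \<in> carrier (Gamma K v)" "s \<in> carrier (Gamma K v)"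
      and s: "psum (Gamma K v) a b = Some s"
    then have i: "a \<in> ?J" "b \<in> ?J" "s \<in> ?J" by (simp_all add: Gamma_def)
    then show "psum (Gamma H u) (?h' a) (?h' b) = Some (?h' s)"
      using s psumK[OF i] psumH[of "?h' a" "?h' b" "?h' s"] mult[of "?h' a" "?h' b" "?h' s"] h' by simp
  qed (use h'c h' in \<open>simp_all add: Gamma_def\<close>)
  ultimately show ?thesis
    using bij by (simp add: pea_iso_def) (simp add: Gamma_def)
qed

text \<open>
  The data that an \<open>n\<close>-perfect decomposition and a central element \<open>c\<close> induce on an interval
  \<open>[\<one>, u]\<close>: the index of the part of the decomposition becomes a degree.
\<close>

locale graded_interval = po_group H
  for H :: "'h po_group" and u c :: 'h and deg :: "'h \<Rightarrow> nat" and n :: nat +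
  assumes n_pos: "1 \<le> n"
    and center: "c \<in> group_center H"
    and interval: "c \<in> unit_interval H u"
    and pow: "c [^]\<^bsub>H\<^esub> n = u"
    and deg_c: "deg c = 1"
    and deg_mult: "\<lbrakk>x \<in> unit_interval H u; y \<in> unit_interval H u; po_le H (x \<otimes>\<^bsub>H\<^esub> y) u\<rbrakk>
      \<Longrightarrow> deg (x \<otimes>\<^bsub>H\<^esub> y) = deg x + deg y"
    and mult_le_unit: "\<lbrakk>x \<in> unit_interval H u; y \<in> unit_interval H u; deg x + deg y < n\<rbrakk>
      \<Longrightarrow> po_le H (x \<otimes>\<^bsub>H\<^esub> y) u"
    and refinement: "\<lbrakk>a1 \<in> unit_interval H u; a2 \<in> unit_interval H u; b1 \<in> unit_interval H u;
        b2 \<in> unit_interval H u; a1 \<otimes>\<^bsub>H\<^esub> a2 = b1 \<otimes>\<^bsub>H\<^esub> b2; po_le H (a1 \<otimes>\<^bsub>H\<^esub> a2) u\<rbrakk>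
      \<Longrightarrow> RDP1_refinement H a1 a2 b1 b2"
begin

abbreviation I :: "'h set" where "I \<equiv> unit_interval H u"

lemma c_closed [simp]: "c \<in> carrier H" and c_ge_one [simp]: "po_le H \<one>\<^bsub>H\<^esub> c"
  using interval by (auto simp: unit_interval_def)

lemma unit_closed [simp]: "u \<in> carrier H" and unit_ge_one [simp]: "po_le H \<one>\<^bsub>H\<^esub> u"
  using pow one_le_pow[of c n] nat_pow_closed[of c n] by simp_all

lemma intervalI: "\<lbrakk>x \<in> carrier H; po_le H \<one>\<^bsub>H\<^esub> x; po_le H x u\<rbrakk> \<Longrightarrow> x \<in> I"
  by (simp add: unit_interval_def)

lemma intervalD: "x \<in> I \<Longrightarrow> x \<in> carrier H" "x \<in> I \<Longrightarrow> po_le H \<one>\<^bsub>H\<^esub> x" "x \<in> I \<Longrightarrow> po_le H x u"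
  by (simp_all add: unit_interval_def)

lemma one_interval: "\<one>\<^bsub>H\<^esub> \<in> I" and unit_interval: "u \<in> I"
  by (simp_all add: unit_interval_def)

lemma interval_factors:
  assumes "a \<in> carrier H" "b \<in> carrier H" "po_le H \<one>\<^bsub>H\<^esub> a" "po_le H \<one>\<^bsub>H\<^esub> b" "a \<otimes>\<^bsub>H\<^esub> b \<in> I"
  shows "a \<in> I" "b \<in> I" "deg (a \<otimes>\<^bsub>H\<^esub> b) = deg a + deg b"
proof -
  have "po_le H a (a \<otimes>\<^bsub>H\<^esub> b)" "po_le H b (a \<otimes>\<^bsub>H\<^esub> b)"
    using assms le_mult_right le_mult_left by auto
  then show *: "a \<in> I" "b \<in> I"
    using assms le_trans[of _ "a \<otimes>\<^bsub>H\<^esub> b" u] by (auto intro!: intervalI dest: intervalD)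
  show "deg (a \<otimes>\<^bsub>H\<^esub> b) = deg a + deg b"
    using assms intervalD(3) by (intro deg_mult *) auto
qed

lemma c_pow_comm: "x \<in> carrier H \<Longrightarrow> x \<otimes>\<^bsub>H\<^esub> c [^]\<^bsub>H\<^esub> (k::nat) = c [^]\<^bsub>H\<^esub> k \<otimes>\<^bsub>H\<^esub> x"
  using group_commutes_pow[of c x k] center by (simp add: group_center_def)

lemma c_pow_interval: "k \<le> n \<Longrightarrow> c [^]\<^bsub>H\<^esub> k \<in> I"
  using interval_factors(1)[of "c [^]\<^bsub>H\<^esub> k" "c [^]\<^bsub>H\<^esub> (n - k)"]
  by (simp add: one_le_pow nat_pow_mult pow unit_interval)

lemma deg_one: "deg \<one>\<^bsub>H\<^esub> = 0"
  using deg_mult[OF one_interval one_interval] by simp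

lemma deg_c_pow: "k \<le> n \<Longrightarrow> deg (c [^]\<^bsub>H\<^esub> k) = k"
proof (induction k)
  case (Suc k)
  then have "deg (c [^]\<^bsub>H\<^esub> k \<otimes>\<^bsub>H\<^esub> c) = deg (c [^]\<^bsub>H\<^esub> k) + deg c"
    using c_pow_interval[of "Suc k"] by (intro interval_factors(3)) (simp_all add: one_le_pow)
  then show ?case using Suc by (simp add: deg_c)
qed (simp add: deg_one)

lemma deg_unit: "deg u = n"
  using deg_c_pow[of n] by (simp add: pow)

lemma deg_le: "x \<in> I \<Longrightarrow> deg x \<le> n"
  using interval_factors(3)[of x "inv\<^bsub>H\<^esub> x \<otimes>\<^bsub>H\<^esub> u"] unit_interval
  by (simp add: intervalD deg_unit flip: le_iff_left)

text \<open>The elements of degree zero; they will be the positive cone of the group \<open>G\<close>.\<close>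

definition P :: "'h set" where
  "P = {x \<in> I. deg x = 0}"

lemma P_closed: "x \<in> P \<Longrightarrow> x \<in> carrier H" and P_ge_one: "x \<in> P \<Longrightarrow> po_le H \<one>\<^bsub>H\<^esub> x"
  and P_interval: "x \<in> P \<Longrightarrow> x \<in> I"
  by (auto simp: P_def unit_interval_def)

lemma P_one: "\<one>\<^bsub>H\<^esub> \<in> P"
  by (simp add: P_def one_interval deg_one)

lemma P_mult: "\<lbrakk>x \<in> P; y \<in> P\<rbrakk> \<Longrightarrow> x \<otimes>\<^bsub>H\<^esub> y \<in> P"
  using deg_mult[of x y] mult_le_unit[of x y] n_pos one_le_mult[of x y]
  by (auto simp: P_def unit_interval_def)

lemma P_factors:
  assumes "a \<in> carrier H" "b \<in> carrier H" "po_le H \<one>\<^bsub>H\<^esub> a" "po_le H \<one>\<^bsub>H\<^esub> b" "a \<otimes>\<^bsub>H\<^esub> b \<in> P"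
  shows "a \<in> P" "b \<in> P"
  using interval_factors[of a b] assms by (auto simp: P_def)

lemma P_conj:
  assumes "a \<in> P" "x \<in> P"
  shows "inv\<^bsub>H\<^esub> x \<otimes>\<^bsub>H\<^esub> a \<otimes>\<^bsub>H\<^esub> x \<in> P"
  using P_factors(2)[of x "inv\<^bsub>H\<^esub> x \<otimes>\<^bsub>H\<^esub> a \<otimes>\<^bsub>H\<^esub> x"] P_mult[of a x] one_le_conj[of a x] assms
  by (simp add: P_closed P_ge_one m_assoc)

text \<open>The carrier of the group \<open>G\<close>: the quotients of elements of degree zero.\<close>

definition Q :: "'h set" where
  "Q = {a \<otimes>\<^bsub>H\<^esub> inv\<^bsub>H\<^esub> b | a b. a \<in> P \<and> b \<in> P}"

lemma QI: "\<lbrakk>a \<in> P; b \<in> P\<rbrakk> \<Longrightarrow> a \<otimes>\<^bsub>H\<^esub> inv\<^bsub>H\<^esub> b \<in> Q"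
  by (auto simp: Q_def)

lemma QE:
  assumes "g \<in> Q"
  obtains a b where "a \<in> P" "b \<in> P" "g = a \<otimes>\<^bsub>H\<^esub> inv\<^bsub>H\<^esub> b"
  using assms by (auto simp: Q_def)

lemma Q_closed: "g \<in> Q \<Longrightarrow> g \<in> carrier H"
  by (auto simp: Q_def P_closed)

lemma P_subset_Q: "a \<in> P \<Longrightarrow> a \<in> Q"
  using QI[of a "\<one>\<^bsub>H\<^esub>"] by (simp add: P_one P_closed)

lemma Q_inv: "g \<in> Q \<Longrightarrow> inv\<^bsub>H\<^esub> g \<in> Q"
  by (erule QE) (simp add: inv_mult_group P_closed QI)

lemma Q_mult:
  assumes "g \<in> Q" "h \<in> Q"
  shows "g \<otimes>\<^bsub>H\<^esub> h \<in> Q"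
proof -
  obtain a b where ab: "a \<in> P" "b \<in> P" "g = a \<otimes>\<^bsub>H\<^esub> inv\<^bsub>H\<^esub> b" using assms by (auto elim: QE)
  obtain a' b' where ab': "a' \<in> P" "b' \<in> P" "h = a' \<otimes>\<^bsub>H\<^esub> inv\<^bsub>H\<^esub> b'" using assms by (auto elim: QE)
  have "g \<otimes>\<^bsub>H\<^esub> h = (a \<otimes>\<^bsub>H\<^esub> a') \<otimes>\<^bsub>H\<^esub> inv\<^bsub>H\<^esub> (b' \<otimes>\<^bsub>H\<^esub> (inv\<^bsub>H\<^esub> a' \<otimes>\<^bsub>H\<^esub> b \<otimes>\<^bsub>H\<^esub> a'))"
    using ab ab' by (simp add: P_closed m_assoc inv_mult_group)
  then show ?thesis using QI P_mult P_conj ab ab' by simp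
qed

lemma Q_subgroup: "subgroup Q H"
  by (rule subgroupI) (use P_subset_Q P_one Q_closed Q_inv Q_mult in auto)

lemma P_of_Q:
  assumes "g \<in> Q" "po_le H \<one>\<^bsub>H\<^esub> g"
  shows "g \<in> P"
proof -
  obtain a b where "a \<in> P" "b \<in> P" "g = a \<otimes>\<^bsub>H\<^esub> inv\<^bsub>H\<^esub> b" using assms by (auto elim: QE)
  then have "g \<otimes>\<^bsub>H\<^esub> b \<in> P" "b \<in> P" by (simp_all add: P_closed m_assoc)
  then show ?thesis using P_factors(1)[of g b] assms Q_closed P_closed P_ge_one by blast
qed

text \<open>The \<open>G\<close>-component of an element of the interval: what is left after dividing by the power of \<open>c\<close>.\<close>

definition offset :: "'h \<Rightarrow> 'h" where
  "offset x = inv\<^bsub>H\<^esub> (c [^]\<^bsub>H\<^esub> deg x) \<otimes>\<^bsub>H\<^esub> x"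

lemma c_pow_offset: "x \<in> I \<Longrightarrow> c [^]\<^bsub>H\<^esub> deg x \<otimes>\<^bsub>H\<^esub> offset x = x"
  by (simp add: offset_def intervalD)

lemma offset_closed: "x \<in> I \<Longrightarrow> offset x \<in> carrier H"
  by (simp add: offset_def intervalD)

lemma offset_mult:
  assumes "x \<in> I" "y \<in> I"
  shows "offset x \<otimes>\<^bsub>H\<^esub> offset y = inv\<^bsub>H\<^esub> (c [^]\<^bsub>H\<^esub> (deg x + deg y)) \<otimes>\<^bsub>H\<^esub> (x \<otimes>\<^bsub>H\<^esub> y)"
proof -
  let ?a = "c [^]\<^bsub>H\<^esub> deg x" and ?b = "c [^]\<^bsub>H\<^esub> deg y" and ?x = "offset x" and ?y = "offset y"
  have xy [simp]: "?x \<in> carrier H" "?y \<in> carrier H" "?a \<in> carrier H" "?b \<in> carrier H"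
    using assms by (simp_all add: offset_closed)
  have comm: "?x \<otimes>\<^bsub>H\<^esub> ?b = ?b \<otimes>\<^bsub>H\<^esub> ?x" by (rule c_pow_comm) simp
  have "x \<otimes>\<^bsub>H\<^esub> y = (?a \<otimes>\<^bsub>H\<^esub> ?x) \<otimes>\<^bsub>H\<^esub> (?b \<otimes>\<^bsub>H\<^esub> ?y)"
    using assms by (simp only: c_pow_offset)
  also have "\<dots> = ?a \<otimes>\<^bsub>H\<^esub> (?x \<otimes>\<^bsub>H\<^esub> ?b) \<otimes>\<^bsub>H\<^esub> ?y"
    by (simp add: m_assoc)
  also have "\<dots> = ?a \<otimes>\<^bsub>H\<^esub> ?b \<otimes>\<^bsub>H\<^esub> (?x \<otimes>\<^bsub>H\<^esub> ?y)"
    unfolding comm by (simp add: m_assoc)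
  also have "?a \<otimes>\<^bsub>H\<^esub> ?b = c [^]\<^bsub>H\<^esub> (deg x + deg y)" by (rule nat_pow_mult) simp
  finally have "x \<otimes>\<^bsub>H\<^esub> y = c [^]\<^bsub>H\<^esub> (deg x + deg y) \<otimes>\<^bsub>H\<^esub> (?x \<otimes>\<^bsub>H\<^esub> ?y)" .
  then show ?thesis using assms by (simp add: offset_closed)
qed

lemma offset_interval_mult:
  assumes "x \<in> I" "y \<in> I" "x \<otimes>\<^bsub>H\<^esub> y \<in> I"
  shows "offset (x \<otimes>\<^bsub>H\<^esub> y) = offset x \<otimes>\<^bsub>H\<^esub> offset y"
proof -
  have "deg (x \<otimes>\<^bsub>H\<^esub> y) = deg x + deg y" using assms intervalD(3) by (intro deg_mult) auto
  then show ?thesis by (simp only: offset_mult[OF assms(1,2)]) (simp add: offset_def)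
qed

text \<open>
  Every element \<open>x\<close> of the interval satisfies \<open>x \<le> c [^] n\<close>. By (RDP1) it is a product of \<open>n\<close>
  elements below \<open>c\<close>. These have degree zero, or differ from \<open>c\<close> by an element of degree zero.
\<close>

lemma offset_in_Q_aux:
  assumes "m \<le> n" "x \<in> I" "po_le H x (c [^]\<^bsub>H\<^esub> m)"
  shows "offset x \<in> Q"
  using assms
proof (induction m arbitrary: x)
  case 0
  then have "x = \<one>\<^bsub>H\<^esub>" by (intro le_antisym) (auto dest: intervalD)
  then show ?case using P_subset_Q[OF P_one] by (simp add: offset_def deg_one)
next
  case (Suc m)
  note x = intervalD[OF Suc.prems(2)]
  let ?e = "inv\<^bsub>H\<^esub> x \<otimes>\<^bsub>H\<^esub> c [^]\<^bsub>H\<^esub> Suc m"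
  have prod: "x \<otimes>\<^bsub>H\<^esub> ?e = c [^]\<^bsub>H\<^esub> m \<otimes>\<^bsub>H\<^esub> c" using x by simp
  have top: "c [^]\<^bsub>H\<^esub> m \<otimes>\<^bsub>H\<^esub> c \<in> I" using c_pow_interval[OF Suc.prems(1)] by simp
  have "po_le H \<one>\<^bsub>H\<^esub> ?e" using Suc.prems(3) x le_iff_left[of x "c [^]\<^bsub>H\<^esub> Suc m"] by simp
  then have e: "?e \<in> I" using interval_factors(2)[of x ?e] x prod top by simp
  have m: "c [^]\<^bsub>H\<^esub> m \<in> I" using Suc.prems by (intro c_pow_interval) simp
  have "RDP1_refinement H x ?e (c [^]\<^bsub>H\<^esub> m) c"
    using intervalD(3)[OF top] prod by (intro refinement[OF Suc.prems(2) e m interval]) simp_all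
  then obtain c11 c12 c21 c22 where
    pos: "c11 \<in> positive_cone H" "c12 \<in> positive_cone H"
      "c21 \<in> positive_cone H" "c22 \<in> positive_cone H"
    and eqs: "c11 \<otimes>\<^bsub>H\<^esub> c12 = x" "c21 \<otimes>\<^bsub>H\<^esub> c22 = ?e"
      "c11 \<otimes>\<^bsub>H\<^esub> c21 = c [^]\<^bsub>H\<^esub> m" "c12 \<otimes>\<^bsub>H\<^esub> c22 = c"
    by (rule RDP1_refinementE)
  note pos = pos[unfolded positive_cone_def, simplified]
  have c11: "c11 \<in> I" and c12: "c12 \<in> I" and c22: "c22 \<in> I" and d: "deg c12 + deg c22 = 1"
    using interval_factors[of c11 c12] interval_factors[of c12 c22] pos Suc.prems(2) interval
    by (simp_all add: eqs deg_c)
  have "offset c11 \<in> Q"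
    using Suc.IH[of c11] Suc.prems(1) c11 le_mult_right[of c21 c11] pos by (simp add: eqs)
  moreover have "offset c12 \<in> Q"
  proof (cases "deg c12 = 0")
    case True
    then show ?thesis using P_subset_Q[of c12] pos c12 by (simp add: offset_def P_def)
  next
    case False
    then have "deg c12 = 1" "c22 \<in> P" using d c22 by (auto simp: P_def)
    moreover have "inv\<^bsub>H\<^esub> c \<otimes>\<^bsub>H\<^esub> c12 = inv\<^bsub>H\<^esub> c22"
    proof -
      have "c12 = c \<otimes>\<^bsub>H\<^esub> inv\<^bsub>H\<^esub> c22" using pos by (simp add: m_assoc flip: eqs(4))
      then show ?thesis using pos by simp
    qed
    ultimately show ?thesis using Q_inv P_subset_Q by (simp add: offset_def)
  qed
  ultimately show ?case
    using Q_mult offset_interval_mult[OF c11 c12] Suc.prems(2) by (simp add: eqs)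
qed

lemma offset_in_Q: "x \<in> I \<Longrightarrow> offset x \<in> Q"
  using offset_in_Q_aux[of n x] intervalD(3)[of x] by (simp add: pow)

text \<open>
  The converse of \<open>offset_in_Q\<close>. The hypotheses at \<open>i = 0\<close> and \<open>i = n\<close> say that \<open>(i, g)\<close> lies between
  \<open>(0, \<one>)\<close> and \<open>(n, \<one>)\<close>.
\<close>

lemma c_pow_mult_Q:
  assumes g: "g \<in> Q" and i: "i \<le> n" "i = 0 \<longrightarrow> po_le H \<one>\<^bsub>H\<^esub> g" "i = n \<longrightarrow> po_le H g \<one>\<^bsub>H\<^esub>"
  shows "c [^]\<^bsub>H\<^esub> i \<otimes>\<^bsub>H\<^esub> g \<in> I \<and> deg (c [^]\<^bsub>H\<^esub> i \<otimes>\<^bsub>H\<^esub> g) = i"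
proof -
  consider "i = 0" | "i = n" | "0 < i" "i < n" using i(1) by linarith
  then show ?thesis
  proof cases
    case 1
    then show ?thesis using P_of_Q[OF g] i(2) Q_closed[OF g] by (simp add: P_def)
  next
    case 2
    have gH: "g \<in> carrier H" using g by (rule Q_closed)
    have "po_le H \<one>\<^bsub>H\<^esub> (inv\<^bsub>H\<^esub> g)" using 2 i(3) gH le_iff_left[of g "\<one>\<^bsub>H\<^esub>"] by simp
    then have ig: "inv\<^bsub>H\<^esub> g \<in> P" using P_of_Q Q_inv g by blast
    have "po_le H \<one>\<^bsub>H\<^esub> (u \<otimes>\<^bsub>H\<^esub> g)"
      using le_iff_right[of "inv\<^bsub>H\<^esub> g" u] intervalD(3)[OF P_interval[OF ig]] gH by simp
    then have "u \<otimes>\<^bsub>H\<^esub> g \<in> I" "deg u = deg (u \<otimes>\<^bsub>H\<^esub> g) + deg (inv\<^bsub>H\<^esub> g)"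
      using interval_factors[of "u \<otimes>\<^bsub>H\<^esub> g" "inv\<^bsub>H\<^esub> g"] gH unit_interval P_ge_one[OF ig]
      by (simp_all add: m_assoc)
    moreover have "deg (inv\<^bsub>H\<^esub> g) = 0" using ig by (simp add: P_def)
    ultimately show ?thesis unfolding 2 pow deg_unit by linarith
  next
    case 3
    obtain a b where ab: "a \<in> P" "b \<in> P" "g = a \<otimes>\<^bsub>H\<^esub> inv\<^bsub>H\<^esub> b" using g by (rule QE)
    have abH: "a \<in> carrier H" "b \<in> carrier H" using ab P_closed by auto
    let ?e = "c [^]\<^bsub>H\<^esub> i \<otimes>\<^bsub>H\<^esub> inv\<^bsub>H\<^esub> b"
    \<comment> \<open>The total degree is \<open>n - i < n\<close>, so the product exists in the interval; thus \<open>b \<le> c [^] i\<close>.\<close>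
    have "po_le H (b \<otimes>\<^bsub>H\<^esub> c [^]\<^bsub>H\<^esub> (n - i)) u"
      using 3 ab by (intro mult_le_unit c_pow_interval) (simp_all add: P_def deg_c_pow)
    also have "u = c [^]\<^bsub>H\<^esub> i \<otimes>\<^bsub>H\<^esub> c [^]\<^bsub>H\<^esub> (n - i)" using i(1) by (simp add: nat_pow_mult pow)
    finally have "po_le H b (c [^]\<^bsub>H\<^esub> i)"
      using mult_le_mult_right[of "b \<otimes>\<^bsub>H\<^esub> c [^]\<^bsub>H\<^esub> (n - i)" "c [^]\<^bsub>H\<^esub> i \<otimes>\<^bsub>H\<^esub> c [^]\<^bsub>H\<^esub> (n - i)"
        "inv\<^bsub>H\<^esub> (c [^]\<^bsub>H\<^esub> (n - i))"] abH by (simp add: m_assoc)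
    then have e1: "po_le H \<one>\<^bsub>H\<^esub> ?e" using abH le_iff_right[of b "c [^]\<^bsub>H\<^esub> i"] by simp
    have "?e \<otimes>\<^bsub>H\<^esub> b = c [^]\<^bsub>H\<^esub> i" using abH by (simp add: m_assoc)
    then have eb: "?e \<otimes>\<^bsub>H\<^esub> b \<in> I" "deg (?e \<otimes>\<^bsub>H\<^esub> b) = i"
      using c_pow_interval[OF i(1)] deg_c_pow[OF i(1)] by (simp_all only:)
    have eH: "?e \<in> carrier H" using abH by simp
    note factors = interval_factors[OF eH abH(2) e1 P_ge_one[OF ab(2)] eb(1)]
    have "deg b = 0" using ab(2) by (simp add: P_def)
    then have e: "?e \<in> I" "deg ?e = i" using factors(1,3) eb(2) by simp_all
    have le: "po_le H (a \<otimes>\<^bsub>H\<^esub> ?e) u"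
      using 3 e ab by (intro mult_le_unit) (simp_all add: P_def)
    then have "a \<otimes>\<^bsub>H\<^esub> ?e \<in> I"
      by (intro intervalI) (use abH eH e1 P_ge_one[OF ab(1)] one_le_mult in auto)
    moreover have "deg (a \<otimes>\<^bsub>H\<^esub> ?e) = i"
      using deg_mult[OF P_interval[OF ab(1)] e(1) le] e(2) ab(1) by (simp add: P_def)
    moreover have "a \<otimes>\<^bsub>H\<^esub> ?e = c [^]\<^bsub>H\<^esub> i \<otimes>\<^bsub>H\<^esub> g"
      using abH c_pow_comm[of a i] by (simp add: ab(3) flip: m_assoc)
    ultimately show ?thesis by simp
  qed
qed

text \<open>The po-group \<open>G\<close>, ordered as a subgroup of \<open>H\<close>.\<close>

definition G :: "'h po_group" where
  "G = subgroup_generated H Q"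

lemma G_carrier [simp]: "carrier G = Q"
  unfolding G_def by (rule subgroup.carrier_subgroup_generated_subgroup[OF Q_subgroup])

lemma G_simps [simp]: "x \<otimes>\<^bsub>G\<^esub> y = x \<otimes>\<^bsub>H\<^esub> y" "\<one>\<^bsub>G\<^esub> = \<one>\<^bsub>H\<^esub>" "po_le G = po_le H"
  by (simp_all add: G_def) (simp add: subgroup_generated_def)

lemma G_po_group: "po_group G"
  unfolding G_def by (rule po_group_subgroup_generated) (rule po_group_axioms)

lemma G_cone: "positive_cone G = P"
  using P_of_Q P_subset_Q P_ge_one by (auto simp: positive_cone_def)

lemma G_torsion_free: "torsion_free H \<Longrightarrow> torsion_free G"
  using Q_closed int_pow_subgroup_generated[of _ Q] G_carrier
  by (auto simp: torsion_free_def simp flip: G_def)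

lemma G_directed: "po_directed G"
  unfolding po_directed_def
proof (intro ballI)
  fix g h assume "g \<in> carrier G" "h \<in> carrier G"
  then obtain a b a' b' where ab: "a \<in> P" "b \<in> P" "g = a \<otimes>\<^bsub>H\<^esub> inv\<^bsub>H\<^esub> b"
    and ab': "a' \<in> P" "b' \<in> P" "h = a' \<otimes>\<^bsub>H\<^esub> inv\<^bsub>H\<^esub> b'"
    by (auto simp: Q_def)
  note [simp] = P_closed[OF ab(1)] P_closed[OF ab(2)] P_closed[OF ab'(1)] P_closed[OF ab'(2)]
    P_ge_one[OF ab(1)] P_ge_one[OF ab(2)] P_ge_one[OF ab'(1)] P_ge_one[OF ab'(2)]
  have "po_le H g a" using le_mult_right[of b g] by (simp add: ab(3) m_assoc)
  moreover have "po_le H h a'" using le_mult_right[of b' h] by (simp add: ab'(3) m_assoc)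
  ultimately have "po_le H g (a \<otimes>\<^bsub>H\<^esub> a')" "po_le H h (a \<otimes>\<^bsub>H\<^esub> a')"
    using le_trans[of g a "a \<otimes>\<^bsub>H\<^esub> a'"] le_trans[of h a' "a \<otimes>\<^bsub>H\<^esub> a'"]
      le_mult_right[of a' a] le_mult_left[of a a'] ab(3) ab'(3) by simp_all
  then show "\<exists>k\<in>carrier G. po_le G g k \<and> po_le G h k"
    using P_subset_Q[OF P_mult[OF ab(1) ab'(1)]] by auto
qed

lemma G_RDP1: "po_group_RDP1 G"
  unfolding po_group_RDP1_iff
proof (intro ballI impI)
  fix a1 a2 b1 b2
  assume "a1 \<in> positive_cone G" "a2 \<in> positive_cone G" "b1 \<in> positive_cone G" "b2 \<in> positive_cone G"
    and eq: "a1 \<otimes>\<^bsub>G\<^esub> a2 = b1 \<otimes>\<^bsub>G\<^esub> b2"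
  then have P: "a1 \<in> P" "a2 \<in> P" "b1 \<in> P" "b2 \<in> P" by (simp_all add: G_cone)
  have "RDP1_refinement H a1 a2 b1 b2"
    using P eq P_mult[OF P(1,2)] intervalD(3) P_interval by (intro refinement) simp_all
  then obtain c11 c12 c21 c22 where
    pos: "c11 \<in> positive_cone H" "c12 \<in> positive_cone H"
      "c21 \<in> positive_cone H" "c22 \<in> positive_cone H"
    and eqs: "c11 \<otimes>\<^bsub>H\<^esub> c12 = a1" "c21 \<otimes>\<^bsub>H\<^esub> c22 = a2" "c11 \<otimes>\<^bsub>H\<^esub> c21 = b1" "c12 \<otimes>\<^bsub>H\<^esub> c22 = b2"
    and comm: "\<forall>x\<in>positive_cone H. \<forall>y\<in>positive_cone H. po_le H x c12 \<and> po_le H y c21 \<longrightarrow>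
      x \<otimes>\<^bsub>H\<^esub> y = y \<otimes>\<^bsub>H\<^esub> x"
    by (rule RDP1_refinementE)
  have "c11 \<in> P" "c12 \<in> P" "c21 \<in> P" "c22 \<in> P"
    using P_factors[of c11 c12] P_factors[of c21 c22] pos P eqs by (simp_all add: positive_cone_def)
  then show "RDP1_refinement G a1 a2 b1 b2"
  proof (intro RDP1_refinementI[of c11 G c12 c21 c22])
    fix x y assume xy: "x \<in> positive_cone G" "y \<in> positive_cone G" "po_le G x c12" "po_le G y c21"
    then have "x \<in> positive_cone H" "y \<in> positive_cone H"
      unfolding G_cone using P_closed P_ge_one by (simp_all add: positive_cone_def)
    then show "x \<otimes>\<^bsub>G\<^esub> y = y \<otimes>\<^bsub>G\<^esub> x" using comm xy(3,4) unfolding G_simps by blast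
  qed (simp_all add: G_cone eqs)
qed

lemma interval_iso:
  "(\<lambda>x. (int (deg x), offset x)) \<in> pea_iso (Gamma H u) (Gamma (lex_int_prod G) (int n, \<one>\<^bsub>G\<^esub>))"
    (is "?\<phi> \<in> pea_iso _ (Gamma ?L ?u)")
proof (rule Gamma_isoI[OF po_group_axioms])
  show "po_group ?L" by (rule po_group.lex_int_prod_po_group[OF G_po_group])
  show "u \<in> positive_cone H" "?u \<in> positive_cone ?L"
    using n_pos P_subset_Q[OF P_one] by (simp_all add: positive_cone_def)
  show "?\<phi> \<one>\<^bsub>H\<^esub> = \<one>\<^bsub>?L\<^esub>" "?\<phi> u = ?u"
    by (simp_all add: deg_one deg_unit offset_def pow)
  have le: "po_le ?L (0, \<one>\<^bsub>H\<^esub>) (?\<phi> x)" "po_le ?L (?\<phi> x) ?u" if x: "x \<in> I" for x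
  proof -
    note xI = intervalD[OF x]
    have "offset x = x" if "deg x = 0" using that xI by (simp add: offset_def)
    then show "po_le ?L (0, \<one>\<^bsub>H\<^esub>) (?\<phi> x)" using xI by auto
    have "offset x = inv\<^bsub>H\<^esub> u \<otimes>\<^bsub>H\<^esub> x" if "deg x = n" using that by (simp add: offset_def pow)
    moreover have "po_le H (inv\<^bsub>H\<^esub> u \<otimes>\<^bsub>H\<^esub> x) \<one>\<^bsub>H\<^esub>"
      using xI mult_le_mult_left[of x u "inv\<^bsub>H\<^esub> u"] by simp
    ultimately show "po_le ?L (?\<phi> x) ?u" using deg_le[OF x] by (auto simp: le_less)
  qed
  show "bij_betw ?\<phi> I (unit_interval ?L ?u)"
    unfolding bij_betw_def
  proof
    show "inj_on ?\<phi> I"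
      by (rule inj_onI) (metis Pair_inject c_pow_offset of_nat_eq_iff)
    show "?\<phi> ` I = unit_interval ?L ?u"
    proof (intro equalityI subsetI)
      fix y assume "y \<in> ?\<phi> ` I"
      then show "y \<in> unit_interval ?L ?u"
        using le offset_in_Q by (auto simp: unit_interval_def)
    next
      fix y assume y: "y \<in> unit_interval ?L ?u"
      obtain k g where kg: "y = (k, g)" by (cases y)
      have k: "0 \<le> k" "k \<le> int n" and g: "g \<in> Q"
        using y by (auto simp: kg unit_interval_def)
      define i where "i = nat k"
      have i: "k = int i" using k by (simp add: i_def)
      let ?x = "c [^]\<^bsub>H\<^esub> i \<otimes>\<^bsub>H\<^esub> g"
      have x: "?x \<in> I" "deg ?x = i"
        using c_pow_mult_Q[OF g, of i] k y by (auto simp: kg i unit_interval_def)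
      then have "?\<phi> ?x = y" using Q_closed[OF g] by (simp add: offset_def kg i)
      then show "y \<in> ?\<phi> ` I" using x by blast
    qed
  qed
  fix x y s assume xys: "x \<in> I" "y \<in> I" "s \<in> I"
  show "x \<otimes>\<^bsub>H\<^esub> y = s \<longleftrightarrow> ?\<phi> x \<otimes>\<^bsub>?L\<^esub> ?\<phi> y = ?\<phi> s"
  proof
    assume s: "x \<otimes>\<^bsub>H\<^esub> y = s"
    then have "deg s = deg x + deg y" using deg_mult[of x y] intervalD(3)[OF xys(3)] xys by simp
    then show "?\<phi> x \<otimes>\<^bsub>?L\<^esub> ?\<phi> y = ?\<phi> s" using offset_interval_mult[of x y] xys s by simp
  next
    assume "?\<phi> x \<otimes>\<^bsub>?L\<^esub> ?\<phi> y = ?\<phi> s"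
    then have d: "deg x + deg y = deg s" and "offset x \<otimes>\<^bsub>H\<^esub> offset y = offset s"
      by (simp_all flip: of_nat_add)
    then have "inv\<^bsub>H\<^esub> (c [^]\<^bsub>H\<^esub> deg s) \<otimes>\<^bsub>H\<^esub> (x \<otimes>\<^bsub>H\<^esub> y) = inv\<^bsub>H\<^esub> (c [^]\<^bsub>H\<^esub> deg s) \<otimes>\<^bsub>H\<^esub> s"
      using offset_mult[OF xys(1,2)] by (simp add: offset_def)
    then show "x \<otimes>\<^bsub>H\<^esub> y = s" using xys by (simp add: intervalD)
  qed
qed

end


lemma lex_representation_of_strong_n_perfect_in:
  fixes E :: "'a pea" and H :: "'h po_group"
  assumes E: "pea E" and n: "1 \<le> n" and S: "strong_n_perfect_in n E H u"
  shows "\<exists>G :: 'h po_group. lex_representation n E G"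
proof -
  obtain D f c where D: "n_perfect_decomposition n E D" and RDP: "pea_RDP1 E"
    and U: "unital_po_group H u" and tf: "torsion_free H"
    and f: "f \<in> pea_iso E (Gamma H u)"
    and c: "c \<in> D 1" "pea_multiple E n c = Some (pone E)" "f c \<in> group_center H"
    using S by (auto simp: strong_n_perfect_in_def)
  interpret E: pea E by fact
  interpret H: po_group H using U by (simp add: unital_po_group_def)
  interpret R: interval_representation E H u f
  proof (unfold_locales, goal_cases)
    case 1
    then show ?case using U by (simp add: unital_po_group_def strong_unit_def)
  next
    case (3 a b s)
    then show ?case by (rule E.psum_closed)
  qed (fact f E.zero_closed E.one_closed)+
  have dec: "n_decomposition n E D"
    and ex: "\<And>i j a b. \<lbrakk>i + j < n; a \<in> D i; b \<in> D j\<rbrakk> \<Longrightarrow> psum E a b \<noteq> None"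
    using D unfolding n_perfect_decomposition_def by blast+
  have disj: "i = j" if "i \<le> n" "j \<le> n" "x \<in> D i" "x \<in> D j" for i j x
    using dec that unfolding n_decomposition_def by blast
  have un: "(\<Union>i\<le>n. D i) = carrier E" using dec by (simp add: n_decomposition_def)
  have DE: "x \<in> carrier E" if "i \<le> n" "x \<in> D i" for i x using un that by blast
  have add: "i + j \<le> n \<and> s \<in> D (i + j)"
    if "i \<le> n" "j \<le> n" "x \<in> D i" "y \<in> D j" "psum E x y = Some s" for i j x y s
    using dec that unfolding n_decomposition_def by blast
  \<comment> \<open>The degree is the index of the part of the decomposition, carried over to the interval by \<open>g\<close>.\<close>
  define d where "d x = (THE i. i \<le> n \<and> x \<in> D i)" for x
  have d_eq: "d x = i" if "i \<le> n" "x \<in> D i" for i x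
    unfolding d_def using that disj by (intro the_equality) auto
  have d: "d x \<le> n" "x \<in> D (d x)" if x: "x \<in> carrier E" for x
  proof -
    obtain i where "i \<le> n" "x \<in> D i" using un x by blast
    then show "d x \<le> n" "x \<in> D (d x)" using d_eq by auto
  qed
  define g where "g = inv_into (carrier E) f"
  have g: "g y \<in> carrier E" "f (g y) = y" if "y \<in> unit_interval H u" for y
    using R.bij that unfolding g_def bij_betw_def by (auto simp: inv_into_into f_inv_into_f)
  have gf: "g (f x) = x" if "x \<in> carrier E" for x
    using R.bij that unfolding g_def bij_betw_def by simp
  have cE: "c \<in> carrier E" using DE[of 1 c] n c(1) by simp
  have mult: "y \<in> carrier E \<and> f y = f c [^]\<^bsub>H\<^esub> k" if "pea_multiple E k c = Some y" for k y
    using that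
  proof (induction k arbitrary: y)
    case 0
    then show ?case using E.zero_closed R.rep_zero by auto
  next
    case (Suc k)
    then obtain s where s: "pea_multiple E k c = Some s" "psum E s c = Some y"
      by (auto simp: bind_eq_Some_conv)
    have sE: "s \<in> carrier E" "f s = f c [^]\<^bsub>H\<^esub> k" using Suc.IH[OF s(1)] by auto
    then have "y \<in> carrier E" using E.psum_closed cE s(2) by blast
    then show ?case using R.psum_iff[OF sE(1) cE, of y] s(2) sE(2) by simp
  qed
  interpret I: graded_interval H u "f c" "\<lambda>y. d (g y)" n
  proof (unfold_locales, goal_cases)
    case 4
    show ?case using mult[OF c(2)] R.rep_one by simp
  next
    case 5
    show ?case using gf[OF cE] d_eq[of 1 c] c(1) n by simp
  next
    case (6 x y)
    have "psum E (g x) (g y) \<noteq> None" using R.psum_exists_iff[of "g x" "g y"] 6 g by simp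
    then obtain s where s: "psum E (g x) (g y) = Some s" by auto
    then have sE: "s \<in> carrier E" using E.psum_closed g 6 by blast
    have "d (g x) + d (g y) \<le> n \<and> s \<in> D (d (g x) + d (g y))"
      by (rule add[OF _ _ _ _ s]) (use d g 6 in auto)
    moreover have "x \<otimes>\<^bsub>H\<^esub> y = f s" using R.psum_iff[of "g x" "g y" s] s sE g 6 by simp
    ultimately show ?case using d_eq gf[OF sE] by simp
  next
    case (7 x y)
    have "psum E (g x) (g y) \<noteq> None"
      by (rule ex[OF 7(3)]) (use d g 7 in auto)
    then show ?case using R.psum_exists_iff[of "g x" "g y"] 7 g by simp
  next
    case (8 a1 a2 b1 b2)
    then show ?case by (rule R.RDP1_refinement_in_interval[OF RDP])
  qed (fact n c(3) R.rep_interval[OF cE])+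
  have "(\<lambda>x. (int (d (g x)), I.offset x)) \<circ> f \<in> pea_iso E (Gamma (lex_int_prod I.G) (int n, \<one>\<^bsub>I.G\<^esub>))"
    by (rule pea_iso_comp[OF f I.interval_iso])
      (use n I.P_subset_Q[OF I.P_one] in \<open>simp_all add: Gamma_def unit_interval_def\<close>)
  then have "lex_representation n E I.G"
    unfolding lex_representation_def
    using I.G_po_group I.G_torsion_free[OF tf] I.G_directed
      po_group.RDP1_lex_int_prod[OF I.G_po_group I.G_RDP1 I.G_directed] by blast
  then show ?thesis by blast
qed


section \<open>Uniqueness of the group\<close>

text \<open>
  A directed po-group is determined by its positive cone: every element is a quotient of positive
  elements, and an isomorphism of cones extends to quotients.
\<close>

lemma po_group_iso_of_cone_iso:
  assumes G: "po_group G" "po_directed G" and K: "po_group K" "po_directed K"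
    and bij: "bij_betw h (positive_cone G) (positive_cone K)"
    and hmult: "\<And>x y. \<lbrakk>x \<in> positive_cone G; y \<in> positive_cone G\<rbrakk>
      \<Longrightarrow> h (x \<otimes>\<^bsub>G\<^esub> y) = h x \<otimes>\<^bsub>K\<^esub> h y"
  shows "po_group_iso G K \<noteq> {}"
proof -
  let ?P = "positive_cone G" and ?R = "positive_cone K"
  interpret G: po_group G by fact
  interpret K: po_group K by fact
  have P: "x \<in> carrier G" "po_le G \<one>\<^bsub>G\<^esub> x" if "x \<in> ?P" for x
    using that by (auto simp: positive_cone_def)
  have Pm: "x \<otimes>\<^bsub>G\<^esub> y \<in> ?P" if "x \<in> ?P" "y \<in> ?P" for x y
    using that by (auto simp: positive_cone_def G.one_le_mult)
  have hR: "h x \<in> ?R" if "x \<in> ?P" for x using bij that by (auto simp: bij_betw_def)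
  have hK [simp]: "h x \<in> carrier K" if "x \<in> ?P" for x using hR[OF that] by (auto simp: positive_cone_def)
  have inj: "x = y" if "h x = h y" "x \<in> ?P" "y \<in> ?P" for x y
    using bij that by (auto simp: bij_betw_def inj_on_def)
  have surj: "\<exists>x\<in>?P. h x = y" if "y \<in> ?R" for y
  proof -
    have "y \<in> h ` ?P" using bij that by (simp add: bij_betw_def)
    then show ?thesis by blast
  qed
  have welldef: "h a \<otimes>\<^bsub>K\<^esub> inv\<^bsub>K\<^esub> h b = h a' \<otimes>\<^bsub>K\<^esub> inv\<^bsub>K\<^esub> h b'"
    if a: "a \<in> ?P" "b \<in> ?P" "a' \<in> ?P" "b' \<in> ?P" and eq: "a \<otimes>\<^bsub>G\<^esub> inv\<^bsub>G\<^esub> b = a' \<otimes>\<^bsub>G\<^esub> inv\<^bsub>G\<^esub> b'" for a b a' b'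
  proof -
    note car = P(1)[OF a(1)] P(1)[OF a(2)] P(1)[OF a(3)] P(1)[OF a(4)]
    \<comment> \<open>Expand both fractions to the common denominator \<open>m\<close>.\<close>
    obtain m where m: "m \<in> carrier G" "po_le G b m" "po_le G b' m"
      using G(2) car unfolding po_directed_def by meson
    define p p' where "p = inv\<^bsub>G\<^esub> b \<otimes>\<^bsub>G\<^esub> m" and "p' = inv\<^bsub>G\<^esub> b' \<otimes>\<^bsub>G\<^esub> m"
    have p: "p \<in> ?P" "p' \<in> ?P"
      using m car G.le_iff_left[of b m] G.le_iff_left[of b' m]
      by (simp_all add: p_def p'_def positive_cone_def)
    have "b \<otimes>\<^bsub>G\<^esub> p = b' \<otimes>\<^bsub>G\<^esub> p'" using m car by (simp add: p_def p'_def)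
    then have hb: "h b \<otimes>\<^bsub>K\<^esub> h p = h b' \<otimes>\<^bsub>K\<^esub> h p'" using a p by (simp flip: hmult)
    have "a \<otimes>\<^bsub>G\<^esub> p = (a \<otimes>\<^bsub>G\<^esub> inv\<^bsub>G\<^esub> b) \<otimes>\<^bsub>G\<^esub> m" using m car by (simp add: p_def G.m_assoc)
    also have "\<dots> = a' \<otimes>\<^bsub>G\<^esub> p'" using m car by (simp add: eq p'_def G.m_assoc)
    finally have ha: "h a \<otimes>\<^bsub>K\<^esub> h p = h a' \<otimes>\<^bsub>K\<^esub> h p'" using a p by (simp flip: hmult)
    have "h a \<otimes>\<^bsub>K\<^esub> inv\<^bsub>K\<^esub> h b = (h a \<otimes>\<^bsub>K\<^esub> h p) \<otimes>\<^bsub>K\<^esub> inv\<^bsub>K\<^esub> (h b \<otimes>\<^bsub>K\<^esub> h p)"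
      using a p by (simp add: K.m_assoc K.inv_mult_group)
    also have "\<dots> = h a' \<otimes>\<^bsub>K\<^esub> inv\<^bsub>K\<^esub> h b'"
      unfolding ha hb using a p by (simp add: K.m_assoc K.inv_mult_group)
    finally show ?thesis .
  qed
  define F where "F x = (SOME y. \<exists>a\<in>?P. \<exists>b\<in>?P. x = a \<otimes>\<^bsub>G\<^esub> inv\<^bsub>G\<^esub> b \<and> y = h a \<otimes>\<^bsub>K\<^esub> inv\<^bsub>K\<^esub> h b)" for x
  have F: "F (a \<otimes>\<^bsub>G\<^esub> inv\<^bsub>G\<^esub> b) = h a \<otimes>\<^bsub>K\<^esub> inv\<^bsub>K\<^esub> h b" if "a \<in> ?P" "b \<in> ?P" for a b
    unfolding F_def
  proof (rule some_equality)
    show "\<exists>a'\<in>?P. \<exists>b'\<in>?P. a \<otimes>\<^bsub>G\<^esub> inv\<^bsub>G\<^esub> b = a' \<otimes>\<^bsub>G\<^esub> inv\<^bsub>G\<^esub> b' \<and>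
        h a \<otimes>\<^bsub>K\<^esub> inv\<^bsub>K\<^esub> h b = h a' \<otimes>\<^bsub>K\<^esub> inv\<^bsub>K\<^esub> h b'"
      using that by blast
  qed (use that welldef in metis)
  have quot: "\<exists>a\<in>?P. \<exists>b\<in>?P. x = a \<otimes>\<^bsub>G\<^esub> inv\<^bsub>G\<^esub> b" if "x \<in> carrier G" for x
    using G.directed_quotient[OF G(2) that] .
  have Fcar: "F x \<in> carrier K" if "x \<in> carrier G" for x
    using quot[OF that] by (auto simp: F)
  have Fmult: "F (x \<otimes>\<^bsub>G\<^esub> y) = F x \<otimes>\<^bsub>K\<^esub> F y" if xy: "x \<in> carrier G" "y \<in> carrier G" for x y
  proof -
    obtain a b where ab: "a \<in> ?P" "b \<in> ?P" "x = a \<otimes>\<^bsub>G\<^esub> inv\<^bsub>G\<^esub> b" using quot[OF xy(1)] by blast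
    obtain a' b' where ab': "a' \<in> ?P" "b' \<in> ?P" "y = a' \<otimes>\<^bsub>G\<^esub> inv\<^bsub>G\<^esub> b'" using quot[OF xy(2)] by blast
    note car = P(1)[OF ab(1)] P(1)[OF ab(2)] P(1)[OF ab'(1)] P(1)[OF ab'(2)]
    \<comment> \<open>Conjugating \<open>b\<close> moves its inverse past \<open>a'\<close>.\<close>
    define q where "q = inv\<^bsub>G\<^esub> a' \<otimes>\<^bsub>G\<^esub> b \<otimes>\<^bsub>G\<^esub> a'"
    have q: "q \<in> ?P"
      using G.one_le_conj[OF P(2)[OF ab(2)] car(3,2)] car by (simp add: q_def positive_cone_def)
    have "a' \<otimes>\<^bsub>G\<^esub> q = b \<otimes>\<^bsub>G\<^esub> a'" using car by (simp add: q_def G.m_assoc)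
    then have hq: "h a' \<otimes>\<^bsub>K\<^esub> h q = h b \<otimes>\<^bsub>K\<^esub> h a'" using ab ab' q by (simp flip: hmult)
    have hq': "inv\<^bsub>K\<^esub> h b \<otimes>\<^bsub>K\<^esub> h a' = h a' \<otimes>\<^bsub>K\<^esub> inv\<^bsub>K\<^esub> h q"
    proof -
      have "inv\<^bsub>K\<^esub> h b \<otimes>\<^bsub>K\<^esub> h a' = inv\<^bsub>K\<^esub> h b \<otimes>\<^bsub>K\<^esub> (h a' \<otimes>\<^bsub>K\<^esub> h q) \<otimes>\<^bsub>K\<^esub> inv\<^bsub>K\<^esub> h q"
        using ab ab' q by (simp add: K.m_assoc)
      also have "\<dots> = h a' \<otimes>\<^bsub>K\<^esub> inv\<^bsub>K\<^esub> h q" unfolding hq using ab ab' q by simp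
      finally show ?thesis .
    qed
    have "x \<otimes>\<^bsub>G\<^esub> y = (a \<otimes>\<^bsub>G\<^esub> a') \<otimes>\<^bsub>G\<^esub> inv\<^bsub>G\<^esub> (b' \<otimes>\<^bsub>G\<^esub> q)"
      using car by (simp add: ab(3) ab'(3) q_def G.m_assoc G.inv_mult_group)
    then have "F (x \<otimes>\<^bsub>G\<^esub> y) = h (a \<otimes>\<^bsub>G\<^esub> a') \<otimes>\<^bsub>K\<^esub> inv\<^bsub>K\<^esub> h (b' \<otimes>\<^bsub>G\<^esub> q)"
      using F[OF Pm[OF ab(1) ab'(1)] Pm[OF ab'(2) q]] by simp
    also have "\<dots> = h a \<otimes>\<^bsub>K\<^esub> (h a' \<otimes>\<^bsub>K\<^esub> inv\<^bsub>K\<^esub> h q) \<otimes>\<^bsub>K\<^esub> inv\<^bsub>K\<^esub> h b'"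
      using ab ab' q by (simp add: hmult K.m_assoc K.inv_mult_group)
    also have "\<dots> = F x \<otimes>\<^bsub>K\<^esub> F y"
      using ab ab' q by (simp add: F K.m_assoc flip: hq')
    finally show ?thesis .
  qed
  interpret F: group_hom G K F
    by unfold_locales (use Fcar Fmult in \<open>auto simp: hom_def\<close>)
  have one: "\<one>\<^bsub>G\<^esub> \<in> ?P" by (simp add: positive_cone_def)
  have h1: "h \<one>\<^bsub>G\<^esub> = \<one>\<^bsub>K\<^esub>"
    using hmult[OF one one] hK[OF one] K.r_cancel_one by auto
  have Fh: "F x = h x" if "x \<in> ?P" for x
    using F[OF that one] that P[OF that] by (simp add: h1)
  have cone_iff: "F x \<in> ?R \<longleftrightarrow> x \<in> ?P" if x: "x \<in> carrier G" for x
  proof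
    assume "F x \<in> ?R"
    then obtain e where e: "e \<in> ?P" "h e = F x" using surj by blast
    obtain a b where ab: "a \<in> ?P" "b \<in> ?P" "x = a \<otimes>\<^bsub>G\<^esub> inv\<^bsub>G\<^esub> b" using quot[OF x] by blast
    have "h (e \<otimes>\<^bsub>G\<^esub> b) = h a" using ab e by (simp add: hmult F K.m_assoc)
    then have "e \<otimes>\<^bsub>G\<^esub> b = a" using inj Pm ab e by blast
    then have "x = e" using P(1)[OF ab(2)] P(1)[OF e(1)] by (simp add: ab(3) G.m_assoc flip: \<open>e \<otimes>\<^bsub>G\<^esub> b = a\<close>)
    then show "x \<in> ?P" using e by simp
  qed (simp add: Fh hR)
  have le: "po_le K (F x) (F y) \<longleftrightarrow> po_le G x y" if xy: "x \<in> carrier G" "y \<in> carrier G" for x y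
  proof -
    have "po_le K (F x) (F y) \<longleftrightarrow> F (inv\<^bsub>G\<^esub> x \<otimes>\<^bsub>G\<^esub> y) \<in> ?R"
      using xy K.le_iff_left[of "F x" "F y"] Fcar by (simp add: positive_cone_def)
    also have "\<dots> \<longleftrightarrow> po_le G x y"
      using xy cone_iff[of "inv\<^bsub>G\<^esub> x \<otimes>\<^bsub>G\<^esub> y"] G.le_iff_left[of x y] by (simp add: positive_cone_def)
    finally show ?thesis .
  qed
  have "inj_on F (carrier G)"
  proof (rule inj_onI)
    fix x y assume xy: "x \<in> carrier G" "y \<in> carrier G" and eq: "F x = F y"
    have "po_le G x y" "po_le G y x" using le[of x y] le[of y x] xy eq by simp_all
    then show "x = y" using G.le_antisym xy by blast
  qed
  moreover have "F ` carrier G = carrier K"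
  proof (intro equalityI subsetI)
    fix y assume "y \<in> carrier K"
    then obtain r s where rs: "r \<in> ?R" "s \<in> ?R" "y = r \<otimes>\<^bsub>K\<^esub> inv\<^bsub>K\<^esub> s"
      using K.directed_quotient[OF K(2)] by blast
    then obtain a b where ab: "a \<in> ?P" "h a = r" "b \<in> ?P" "h b = s" using surj by meson
    then have "F (a \<otimes>\<^bsub>G\<^esub> inv\<^bsub>G\<^esub> b) = y" using rs by (simp add: F)
    then show "y \<in> F ` carrier G" using P(1)[OF ab(1)] P(1)[OF ab(3)]
      by (intro image_eqI[of _ _ "a \<otimes>\<^bsub>G\<^esub> inv\<^bsub>G\<^esub> b"]) auto
  qed (use Fcar in auto)
  ultimately have "F \<in> po_group_iso G K"
    using le F.homh by (auto simp: po_group_iso_def iso_def bij_betw_def)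
  then show ?thesis by blast
qed

context lex_interval_representation
begin

lemma level_0_bij: "bij_betw (\<lambda>x. snd (f x)) (level 0) (positive_cone G)"
  unfolding bij_betw_def
proof
  show "inj_on (\<lambda>x. snd (f x)) (level 0)"
    by (rule inj_onI) (simp add: level_def prod_eq_iff flip: rep_eq_iff)
  show "(\<lambda>x. snd (f x)) ` level 0 = positive_cone G"
  proof (intro equalityI subsetI)
    fix g assume "g \<in> (\<lambda>x. snd (f x)) ` level 0"
    then obtain x where x: "x \<in> carrier E" "fst (f x) = 0" "g = snd (f x)" by (auto simp: level_def)
    then show "g \<in> positive_cone G"
      using rep_ge_one[of x] snd_closed[of x] by (cases "f x") (auto simp: positive_cone_def)
  next
    fix g assume "g \<in> positive_cone G"
    then obtain x where "x \<in> carrier E" "f x = (0, g)"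
      using ex_rep[of g 0] n_pos by (auto simp: positive_cone_def)
    then show "g \<in> (\<lambda>x. snd (f x)) ` level 0" by (force simp: level_def)
  qed
qed

lemma level_0_psum:
  assumes "x \<in> level 0" "y \<in> level 0"
  obtains s where "psum E x y = Some s" "s \<in> level 0" "snd (f s) = snd (f x) \<otimes>\<^bsub>G\<^esub> snd (f y)"
proof -
  have xy: "x \<in> carrier E" "y \<in> carrier E" using assms by (auto simp: level_def)
  obtain s where s: "psum E x y = Some s"
    using level_psum_exists[of 0 0 x y] assms n_pos by auto
  then have sE: "s \<in> carrier E" using sum_closed xy by blast
  have "f x \<otimes>\<^bsub>lex_int_prod G\<^esub> f y = f s" using psum_mult[OF xy s] .
  then show thesis
    using that[OF s] assms sE by (cases "f x"; cases "f y"; cases "f s") (auto simp: level_def)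
qed

end

lemma lex_representation_unique:
  fixes E :: "'a pea" and G :: "'g po_group" and K :: "'k po_group"
  assumes E: "pea E" and n: "1 \<le> n" and G: "lex_representation n E G" and K: "lex_representation n E K"
  shows "po_group_iso G K \<noteq> {}"
proof -
  obtain f where f: "f \<in> pea_iso E (Gamma (lex_int_prod G) (int n, \<one>\<^bsub>G\<^esub>))"
    and G': "po_group G" "po_directed G" using G by (auto simp: lex_representation_def)
  obtain k where k: "k \<in> pea_iso E (Gamma (lex_int_prod K) (int n, \<one>\<^bsub>K\<^esub>))"
    and K': "po_group K" "po_directed K" using K by (auto simp: lex_representation_def)
  interpret A: lex_interval_representation E G n f
    by (rule lex_interval_representationI[OF E n G' f])
  interpret B: lex_interval_representation E K n k
    by (rule lex_interval_representationI[OF E n K' k])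
  \<comment> \<open>Both levels are the unique maximal ideal of \<open>E\<close>.\<close>
  have level: "B.level 0 = A.level 0" using A.maximal_ideal_iff B.maximal_ideal_iff by blast
  let ?N = "A.level 0" and ?a = "\<lambda>x. snd (f x)" and ?b = "\<lambda>x. snd (k x)"
  have a: "bij_betw ?a ?N (positive_cone G)" and b: "bij_betw ?b ?N (positive_cone K)"
    using A.level_0_bij B.level_0_bij by (simp_all add: level)
  let ?h = "?b \<circ> inv_into ?N ?a"
  show ?thesis
  proof (rule po_group_iso_of_cone_iso[OF G' K'])
    show "bij_betw ?h (positive_cone G) (positive_cone K)"
      by (rule bij_betw_trans[OF bij_betw_inv_into[OF a] b])
    fix g g' assume "g \<in> positive_cone G" "g' \<in> positive_cone G"
    then have "g \<in> ?a ` ?N" "g' \<in> ?a ` ?N" using a by (simp_all add: bij_betw_def)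
    then obtain x y where x: "x \<in> ?N" "g = ?a x" and y: "y \<in> ?N" "g' = ?a y"
      by blast
    obtain s where s: "psum E x y = Some s" "s \<in> ?N" "?a s = ?a x \<otimes>\<^bsub>G\<^esub> ?a y"
      using A.level_0_psum[OF x(1) y(1)] by blast
    obtain t where t: "psum E x y = Some t" "?b t = ?b x \<otimes>\<^bsub>K\<^esub> ?b y"
      using B.level_0_psum[of x y] x y level by auto
    have inv: "inv_into ?N ?a (?a z) = z" if "z \<in> ?N" for z
      using bij_betw_inv_into_left[OF a that] .
    have "?h (g \<otimes>\<^bsub>G\<^esub> g') = ?b s" using inv[OF s(2)] s(3) x y by simp
    also have "\<dots> = ?h g \<otimes>\<^bsub>K\<^esub> ?h g'" using s(1) t inv[OF x(1)] inv[OF y(1)] x y by simp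
    finally show "?h (g \<otimes>\<^bsub>G\<^esub> g') = ?h g \<otimes>\<^bsub>K\<^esub> ?h g'" .
  qed
qed

lemma strong_n_perfect_of_lex_representation:
  assumes E: "pea E" and n: "1 \<le> n" and G: "lex_representation n E G"
  shows "strong_n_perfect n E"
proof -
  obtain f where f: "f \<in> pea_iso E (Gamma (lex_int_prod G) (int n, \<one>\<^bsub>G\<^esub>))"
    and G': "po_group G" "po_directed G" "torsion_free G" "po_group_RDP1 (lex_int_prod G)"
    using G by (auto simp: lex_representation_def)
  interpret A: lex_interval_representation E G n f
    by (rule lex_interval_representationI[OF E n G'(1,2) f])
  show ?thesis by (rule strong_n_perfectI[OF A.strongly_perfect[OF G'(4,3)] n])
qed


theorem theorem6p7:
  fixes E :: "'a pea" and n :: nat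
  assumes "pea E" and "1 \<le> n"
  shows "(strong_n_perfect n E \<longleftrightarrow>
            (\<exists>G :: 'a group_word po_group. lex_representation n E G)) \<and>
         (\<forall>G :: 'g po_group. lex_representation n E G \<longrightarrow>
            strong_n_perfect n E \<and> po_group_RDP1 G) \<and>
         (\<forall>(G :: 'g po_group) (G' :: 'k po_group).
            lex_representation n E G \<and> lex_representation n E G' \<longrightarrow> po_group_iso G G' \<noteq> {})"
proof (intro conjI allI impI)
  show "strong_n_perfect n E \<longleftrightarrow> (\<exists>G :: 'a group_word po_group. lex_representation n E G)"
  proof
    assume "strong_n_perfect n E"
    then obtain H :: "'a group_word po_group" and u where "strong_n_perfect_in n E H u"
      by (auto simp: strong_n_perfect_def)
    then show "\<exists>G :: 'a group_word po_group. lex_representation n E G"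
      by (rule lex_representation_of_strong_n_perfect_in[OF assms])
  next
    assume "\<exists>G :: 'a group_word po_group. lex_representation n E G"
    then show "strong_n_perfect n E" using strong_n_perfect_of_lex_representation[OF assms] by blast
  qed
next
  fix G :: "'g po_group" assume G: "lex_representation n E G"
  then show "strong_n_perfect n E" by (rule strong_n_perfect_of_lex_representation[OF assms])
  show "po_group_RDP1 G"
    using G by (auto simp: lex_representation_def intro: po_group.RDP1_of_lex_int_prod)
next
  fix G :: "'g po_group" and G' :: "'k po_group"
  assume "lex_representation n E G \<and> lex_representation n E G'"
  then show "po_group_iso G G' \<noteq> {}" using lex_representation_unique[OF assms] by blast
qed

end
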